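(* Let $q\in(1,\infty)$, $q'=q/(q-1)$, $\Delta t>0$, let $h$ be an admissible space step, and let $\mathbf u^0\in\mathbb R^{\mathbb Z}$ satisfy $(\mathbf u^0)_i=0$ for $|i|>M_x$. Then the fully discrete scheme with initial datum $\mathbf u^0$ admits a unique solution $(u_i^n)_{n\in\mathbb N,\,i\in\mathbb Z}$. Moreover, writing $\mathbf u^n=(u_i^n)_{i\in\mathbb Z}$ and $(\mathbf u^n)^{q/2}=((u_i^n)^{q/2})_{i\in\mathbb Z}$, for every $n\in\mathbb N$ $$-\|\mathbf u^n\|_{\mathcal X^\theta_h(I)}^2\le \frac1{q'}\,\frac{\|\mathbf u^{n+1}\|_{\ell^q_h(\mathbb R)}^q-\|\mathbf u^{n}\|_{\ell^q_h(\mathbb R)}^q}{\Delta t}\le -\|\mathbf u^{n+1}\|_{\mathcal X^\theta_h(I)}^2$$ and $$\frac{4}{qq'}\left\|\frac{(\mathbf u^{n+1})^{q/2}-(\mathbf u^{n})^{q/2}}{\Delta t}\right\|_{\ell^2_h(\mathbb R)}^2+\frac12\,\frac{\|\mathbf u^{n+1}\|_{\mathcal X^\theta_h(I)}^2-\|\mathbf u^{n}\|_{\mathcal X^\theta_h(I)}^2}{\Delta t}\le 0 .$$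
   Context: Fix $\theta\in(0,1)$, $L>0$, $I=(-L,L)$. A space step $h>0$ is admissible if $L=(M_x+1)h$ for some integer $M_x\ge1$. Bold letters denote elements of $\mathbb R^{\mathbb Z}$. Powers are odd powers: $a^{s}:=|a|^{s-1}a$ for $a\in\mathbb R\setminus\{0\}$, $s>0$, and $0^s:=0$. Weights: let $C_{1,\theta}=\left(\int_{\mathbb R}\frac{1-\cos\xi}{|\xi|^{1+2\theta}}d\xi\right)^{-1}$ and, for $t>0$, $G(t)=\frac{C_{1,\theta}}{(2-2\theta)(2\theta-1)2\theta}t^{2-2\theta}$ if $2\theta\ne1$, $G(t)=C_{1,\theta}(t-t\log t)$ if $2\theta=1$. The weights are symmetric, $w^h_{-j}=w^h_j$, with $w_0^h:=0$ (its value plays no role) and for $j\ge1$: $w_1^h=h^{-2\theta}\left[\frac{C_{1,\theta}}{2-2\theta}-G''(1)-\frac{G'(3)+3G'(1)}2+G(3)-G(1)\right]$; $w^h_j=2h^{-2\theta}[G'(j+1)+G'(j-1)-G(j+1)+G(j-1)]$ for $j$ even; $w_j^h=h^{-2\theta}\left[-\frac{G'(j+2)+6G'(j)+G'(j-2)}2+G(j+2)-G(j-2)\right]$ for $j\ge3$ odd. (Known fact: there are constants $b_\theta,B_\theta>0$ depending only on $\theta$ with $b_\theta h|jh|^{-1-2\theta}\le w_j^h\le B_\theta h|jh|^{-1-2\theta}$ for $j\neq0$.) Discrete fractional Laplacian: $[(-\Delta)^\theta_h\mathbf f]_i=\sum_{j\in\mathbb Z}w_j^h(f_i-f_{i-j})$.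 Norms: $\|\mathbf f\|_{\ell^q_h(\mathbb R)}=\left(\sum_{i\in\mathbb Z}h|f_i|^q\right)^{1/q}$; $\mathcal X^\theta_h(I)=\{\mathbf f\in\mathbb R^{\mathbb Z}: f_i=0\text{ for }|i|>M_x\}$ with $\|\mathbf f\|_{\mathcal X^\theta_h(I)}=\left(\frac12\sum_{i,j\in\mathbb Z}h\,w_j^h|f_i-f_{i-j}|^2\right)^{1/2}$. Fully discrete scheme with initial datum $\mathbf u^0$: find $(u_i^n)_{n\in\mathbb N,i\in\mathbb Z}$ such that $\frac{(u_i^{n+1})^{q-1}-(u_i^n)^{q-1}}{\Delta t}+[(-\Delta)^\theta_h\mathbf u^{n+1}]_i=0$ for $|i|\le M_x$, $n\ge0$; $u_i^n=0$ for $|i|\ge M_x+1$, $n\ge0$; $u_i^0=(\mathbf u^0)_i$ for $|i|\le M_x$. *)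

theory Defs
  imports "HOL-Analysis.Analysis"
begin

text \<open>Odd power; the value at \<open>a = 0\<close> is \<open>0\<close> because of the factor \<open>a\<close>.\<close>

definition odd_powr :: "real \<Rightarrow> real \<Rightarrow> real" where
  "odd_powr a s = \<bar>a\<bar> powr (s - 1) * a"

text \<open>The integrand takes the irrelevant value \<open>0\<close> at \<open>\<xi> = 0\<close>.\<close>

definition frac_const :: "real \<Rightarrow> real" where
  "frac_const \<theta> =
     inverse (LINT \<xi>|lborel. (1 - cos \<xi>) / \<bar>\<xi>\<bar> powr (1 + 2 * \<theta>))"

definition G :: "real \<Rightarrow> real \<Rightarrow> real" where
  "G \<theta> t =
     (if 2 * \<theta> \<noteq> 1
      then frac_const \<theta> / ((2 - 2 * \<theta>) * (2 * \<theta> - 1) * (2 * \<theta>)) * t powr (2 - 2 * \<theta>)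
      else frac_const \<theta> * (t - t * ln t))"

abbreviation G' :: "real \<Rightarrow> real \<Rightarrow> real" where
  "G' \<theta> \<equiv> deriv (G \<theta>)"

abbreviation G'' :: "real \<Rightarrow> real \<Rightarrow> real" where
  "G'' \<theta> \<equiv> deriv (deriv (G \<theta>))"

text \<open>
  Only arguments \<open>t \<ge> 1\<close> of \<open>G\<close> and its derivatives occur below, so the values of \<open>G\<close> for
  \<open>t \<le> 0\<close> play no role.
\<close>

definition weight_pos :: "real \<Rightarrow> real \<Rightarrow> nat \<Rightarrow> real" where
  "weight_pos \<theta> h j =
     (if j = 0 then 0
      else if j = 1 then
        h powr (- (2 * \<theta>)) *
          (frac_const \<theta> / (2 - 2 * \<theta>) - G'' \<theta> 1 - (G' \<theta> 3 + 3 * G' \<theta> 1) / 2 + G \<theta> 3 - G \<theta> 1)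
      else if even j then
        2 * h powr (- (2 * \<theta>)) *
          (G' \<theta> (real j + 1) + G' \<theta> (real j - 1) - G \<theta> (real j + 1) + G \<theta> (real j - 1))
      else
        h powr (- (2 * \<theta>)) *
          (- ((G' \<theta> (real j + 2) + 6 * G' \<theta> (real j) + G' \<theta> (real j - 2)) / 2)
           + G \<theta> (real j + 2) - G \<theta> (real j - 2)))"

definition weight :: "real \<Rightarrow> real \<Rightarrow> int \<Rightarrow> real" where
  "weight \<theta> h j = weight_pos \<theta> h (nat \<bar>j\<bar>)"

definition frac_laplacian :: "real \<Rightarrow> real \<Rightarrow> (int \<Rightarrow> real) \<Rightarrow> int \<Rightarrow> real" where
  "frac_laplacian \<theta> h f i = (\<Sum>\<^sub>\<infinity>j\<in>UNIV. weight \<theta> h j * (f i - f (i - j)))"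

definition lq_norm :: "real \<Rightarrow> real \<Rightarrow> (int \<Rightarrow> real) \<Rightarrow> real" where
  "lq_norm h q f = (\<Sum>\<^sub>\<infinity>i\<in>UNIV. h * \<bar>f i\<bar> powr q) powr (1 / q)"

text \<open>
  The norm of the space of grid functions vanishing for \<open>\<bar>i\<bar> > M\<close>. The formula does not mention
  \<open>M\<close>; it is used only for members of that space.
\<close>

definition X_norm :: "real \<Rightarrow> real \<Rightarrow> (int \<Rightarrow> real) \<Rightarrow> real" where
  "X_norm \<theta> h f =
     sqrt (1 / 2 * (\<Sum>\<^sub>\<infinity>(i, j)\<in>UNIV. h * weight \<theta> h j * \<bar>f i - f (i - j)\<bar>\<^sup>2))"

definition is_scheme_solution ::
  "real \<Rightarrow> real \<Rightarrow> nat \<Rightarrow> real \<Rightarrow> real \<Rightarrow> (int \<Rightarrow> real) \<Rightarrow> (nat \<Rightarrow> int \<Rightarrow> real) \<Rightarrow> bool" where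
  "is_scheme_solution \<theta> h M q dt u0 u \<longleftrightarrow>
     (\<forall>n i. \<bar>i\<bar> \<le> int M \<longrightarrow>
        (odd_powr (u (Suc n) i) (q - 1) - odd_powr (u n i) (q - 1)) / dt
          + frac_laplacian \<theta> h (u (Suc n)) i = 0) \<and>
     (\<forall>n i. \<bar>i\<bar> \<ge> int M + 1 \<longrightarrow> u n i = 0) \<and>
     (\<forall>i. \<bar>i\<bar> \<le> int M \<longrightarrow> u 0 i = u0 i)"

end

theory Submission
  imports Defs
begin

text \<open>
  Up to the factor \<open>h powr (- 2 \<theta>)\<close>, each weight is an integral of the third derivative
  \<open>C t powr (- 1 - 2 \<theta>)\<close> of \<open>G\<close> against a piecewise quadratic nodal function (plus, for \<open>j = 1\<close>,
  a nonnegative term). For odd \<open>j \<ge> 3\<close> this function is negative on the outer parts of its support,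
  so that nonnegativity of the weight is a quantitative statement; replacing the density by a power
  agreeing with it at the sign change reduces it to lower bounds for logarithms. Hence the discrete
  fractional Laplacian is given on grid functions by a nonnegative symmetric form.

  One step of the scheme is the Euler--Lagrange equation of a strictly convex energy. The two
  inequalities for the \<open>q\<close>-norm follow by testing the step with the new and with the old iterate and
  using Young's inequality; the last one by testing with their difference and using the
  Stroock--Varopoulos inequality.
\<close>

section \<open>Odd powers\<close>

lemma odd_powr_of_nonneg: "0 \<le> a \<Longrightarrow> odd_powr a s = a powr s"
  by (cases "a = 0") (auto simp: odd_powr_def powr_mult_base mult.commute)

lemma odd_powr_minus [simp]: "odd_powr (- a) s = - odd_powr a s"
  by (simp add: odd_powr_def)

lemma abs_odd_powr: "\<bar>odd_powr a s\<bar> = \<bar>a\<bar> powr s"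
  by (cases "a = 0") (auto simp: odd_powr_def abs_mult powr_mult_base mult.commute)

lemma mult_odd_powr: "a * odd_powr a s = \<bar>a\<bar> powr (s + 1)"
proof -
  have "a * odd_powr a s = \<bar>a\<bar> * (\<bar>a\<bar> * \<bar>a\<bar> powr (s - 1))"
    by (simp add: odd_powr_def)
  also have "\<dots> = \<bar>a\<bar> powr (s + 1)"
    by (simp only: powr_mult_base[OF abs_ge_zero]) (simp add: add.commute)
  finally show ?thesis .
qed

lemma odd_powr_0 [simp]: "odd_powr 0 s = 0"
  by (simp add: odd_powr_def)

lemma odd_powr_strict_mono:
  assumes "0 < s" "a < b"
  shows "odd_powr a s < odd_powr b s"
proof -
  consider "0 \<le> a" | "b \<le> 0" | "a < 0" "0 < b" using assms by linarith
  then show ?thesis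
  proof cases
    case 1
    then show ?thesis using assms by (simp add: odd_powr_of_nonneg powr_less_mono2)
  next
    case 2
    then have "odd_powr (- b) s < odd_powr (- a) s"
      using assms by (simp only: odd_powr_of_nonneg) (simp add: odd_powr_of_nonneg powr_less_mono2)
    then show ?thesis by simp
  next
    case 3
    then show ?thesis unfolding odd_powr_def
      by (smt (verit, best) mult_pos_pos mult_pos_neg powr_gt_zero)
  qed
qed

lemma continuous_on_odd_powr [continuous_intros]:
  assumes "0 < s" "continuous_on A f"
  shows "continuous_on A (\<lambda>x. odd_powr (f x) s)"
proof -
  \<comment> \<open>Powers of the positive and the negative part avoid the factor
    \<open>\<bar>a\<bar> powr (s - 1)\<close>, which is singular at \<open>0\<close> for
    \<open>s < 1\<close>.\<close>
  have "odd_powr a s = max a 0 powr s - max (- a) 0 powr s" for a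
    using odd_powr_of_nonneg[of a s] odd_powr_of_nonneg[of "- a" s] by (cases "0 \<le> a") auto
  then show ?thesis
    using assms by (auto intro!: continuous_intros continuous_on_powr')
qed

text \<open>Young's inequality for \<open>\<bar>a\<bar>\<close> and
  \<open>\<bar>b\<bar> powr (q - 1)\<close> with the conjugate exponents \<open>q\<close> and
  \<open>q / (q - 1)\<close>.\<close>

lemma Young_odd_powr:
  assumes "1 < q"
  shows "a * odd_powr b (q - 1) \<le> \<bar>a\<bar> powr q / q + (1 - 1 / q) * \<bar>b\<bar> powr q"
proof -
  have "a * odd_powr b (q - 1) \<le> \<bar>a\<bar> * \<bar>b\<bar> powr (q - 1)"
    by (metis abs_ge_self abs_mult abs_odd_powr)
  also have "\<dots> \<le> \<bar>a\<bar> powr q / q + (\<bar>b\<bar> powr (q - 1)) powr (q / (q - 1)) / (q / (q - 1))"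
    using assms by (intro Youngs_inequality) (auto simp: field_simps)
  also have "\<dots> = \<bar>a\<bar> powr q / q + (1 - 1 / q) * \<bar>b\<bar> powr q"
  proof -
    have "(q - 1) * (q / (q - 1)) = q" using assms by simp
    then show ?thesis
      using assms by (simp only: powr_powr) (simp add: field_simps)
  qed
  finally show ?thesis .
qed

text \<open>Each part is Young's inequality rearranged. The first two serve for testing with the old
  and the new value; the third is the subgradient inequality for
  \<open>\<bar>t\<bar> powr q / q\<close> at \<open>a\<close>.\<close>

lemma odd_powr_convexity:
  assumes "1 < q"
  shows "b * (odd_powr a (q - 1) - odd_powr b (q - 1))
      \<le> (1 - 1 / q) * (\<bar>a\<bar> powr q - \<bar>b\<bar> powr q)" (is ?th1)
    and "(1 - 1 / q) * (\<bar>a\<bar> powr q - \<bar>b\<bar> powr q)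
      \<le> a * (odd_powr a (q - 1) - odd_powr b (q - 1))" (is ?th2)
    and "\<bar>a\<bar> powr q / q - \<bar>b\<bar> powr q / q \<le> odd_powr a (q - 1) * (a - b)" (is ?th3)
proof -
  have *: "c * odd_powr c (q - 1) = \<bar>c\<bar> powr q" for c
    by (simp add: mult_odd_powr)
  show ?th1 ?th2 ?th3
    using Young_odd_powr[OF assms, of b a] Young_odd_powr[OF assms, of a b] *[of a] *[of b]
    by (simp_all add: algebra_simps)
qed

text \<open>
  The discrete form of the Cauchy--Schwarz estimate for \<open>\<integral> \<bar>t\<bar> powr (q/2 - 1)\<close>: for every \<open>l\<close> and
  \<open>t > 0\<close> the function \<open>\<psi> l\<close> below has the square \<open>(l - (q/2) t powr (q/2 - 1))\<^sup>2\<close> as derivative, and the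
  difference quotient of \<open>odd_powr _ (q/2)\<close> is the optimal choice of \<open>l\<close>.
\<close>

lemma odd_powr_auxiliary_mono:
  assumes q: "1 < q" and "a \<le> b"
  defines "\<psi> \<equiv> \<lambda>l t. l\<^sup>2 * t + q\<^sup>2 / (4 * (q - 1)) * odd_powr t (q - 1) - 2 * l * odd_powr t (q / 2)"
  shows "\<psi> l a \<le> \<psi> l b"
proof -
  \<comment> \<open>\<open>1 \<le> K\<close> controls the sign of \<open>\<psi> l\<close>; the
    identity for \<open>K * (q - 1)\<close> makes its derivative a perfect square.\<close>
  define K where "K = q\<^sup>2 / (4 * (q - 1))"
  have K: "1 \<le> K" "K * (q - 1) = (q / 2)\<^sup>2"
  proof -
    have "0 \<le> (q - 2)\<^sup>2" by simp
    then show "1 \<le> K" using q by (simp add: K_def field_simps power2_eq_square)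
    show "K * (q - 1) = (q / 2)\<^sup>2" using q by (simp add: K_def field_simps power2_eq_square)
  qed
  have pos: "\<psi> l x \<le> \<psi> l y" if "0 < x" "x \<le> y" for x y
  proof (rule DERIV_nonneg_imp_nondecreasing[OF \<open>x \<le> y\<close>])
    fix t assume "x \<le> t" "t \<le> y"
    then have t: "0 < t" using that by simp
    let ?f = "\<lambda>t. l\<^sup>2 * t + K * t powr (q - 1) - 2 * l * t powr (q / 2)"
    have "(?f has_real_derivative l\<^sup>2 + K * ((q - 1) * t powr (q - 1 - 1))
        - 2 * l * ((q / 2) * t powr (q / 2 - 1))) (at t)"
      by (intro DERIV_diff DERIV_add DERIV_cmult has_real_derivative_powr t)
        (auto intro!: derivative_eq_intros)
    also have "l\<^sup>2 + K * ((q - 1) * t powr (q - 1 - 1)) - 2 * l * ((q / 2) * t powr (q / 2 - 1))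
        = (l - q / 2 * t powr (q / 2 - 1))\<^sup>2"
    proof -
      have sq: "t powr (q - 1 - 1) = (t powr (q / 2 - 1))\<^sup>2"
        by (simp add: power2_eq_square flip: powr_add)
      have gen: "l\<^sup>2 + K * ((q - 1) * s\<^sup>2) - 2 * l * (r * s) = (l - r * s)\<^sup>2"
        if "K * (q - 1) = r\<^sup>2" for r s :: real
        using that by algebra
      show ?thesis unfolding sq by (rule gen[OF K(2)])
    qed
    finally have "(?f has_real_derivative (l - q / 2 * t powr (q / 2 - 1))\<^sup>2) (at t)" .
    moreover have "eventually (\<lambda>t. \<psi> l t = ?f t) (nhds t)"
      using eventually_nhds_in_open[of "{0<..}" t] t
      by (auto elim!: eventually_mono simp: \<psi>_def K_def odd_powr_of_nonneg)
    ultimately have "(\<psi> l has_real_derivative (l - q / 2 * t powr (q / 2 - 1))\<^sup>2) (at t)"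
      by (subst DERIV_cong_ev[OF refl _ refl]) auto
    then show "\<exists>y. (\<psi> l has_real_derivative y) (at t) \<and> 0 \<le> y" by fastforce
  qed
  \<comment> \<open>The powers may fail to be differentiable at \<open>0\<close>, so an interval
    containing \<open>0\<close> is handled by the sign of \<open>\<psi> l\<close> on either side,
    found by completing the square in \<open>t * \<psi> l t\<close>.\<close>
  have nonneg: "0 \<le> \<psi> l t" if "0 \<le> t" for t
  proof -
    have sq: "t powr (q - 1) * t = (t powr (q / 2))\<^sup>2"
      using that by (cases "t = 0") (auto simp: power2_eq_square powr_mult_base mult.commute simp flip: powr_add)
    have "t * \<psi> l t = (l * t - t powr (q / 2))\<^sup>2 + (K - 1) * (t powr (q / 2))\<^sup>2"
      using that sq unfolding \<psi>_def K_def[symmetric]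
      by (simp add: odd_powr_of_nonneg power2_diff power_mult_distrib algebra_simps power2_eq_square)
    also have "\<dots> \<ge> 0" using K by auto
    finally show ?thesis using that 
      by (cases "t = 0") (auto simp: \<psi>_def zero_le_mult_iff)
  qed
  have odd: "\<psi> l (- t) = - \<psi> l t" for t by (simp add: \<psi>_def)
  consider "0 < a" | "b < 0" | "a \<le> 0" "0 \<le> b" using assms by linarith
  then show ?thesis
  proof cases
    case 1 then show ?thesis using pos assms by blast
  next
    case 2 then show ?thesis using pos[of "- b" "- a"] assms odd by auto
  next
    case 3 then show ?thesis using nonneg[of "- a"] nonneg[of b] odd by auto
  qed
qed

text \<open>Take for \<open>l\<close> the difference quotient of \<open>odd_powr _ (q / 2)\<close>
  in the monotonicity of \<open>\<psi> l\<close> and multiply by \<open>a - b\<close>: the terms in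
  \<open>l\<close> combine to minus the squared difference.\<close>

lemma Stroock_Varopoulos_odd_powr:
  assumes q: "1 < q"
  shows "4 * (q - 1) / q\<^sup>2 * (odd_powr a (q / 2) - odd_powr b (q / 2))\<^sup>2
    \<le> (odd_powr a (q - 1) - odd_powr b (q - 1)) * (a - b)"
proof -
  define K where "K = q\<^sup>2 / (4 * (q - 1))"
  have main: "(odd_powr a (q / 2) - odd_powr b (q / 2))\<^sup>2
      \<le> K * ((odd_powr a (q - 1) - odd_powr b (q - 1)) * (a - b))" if "b < a" for a b
  proof -
    define d where "d = odd_powr a (q / 2) - odd_powr b (q / 2)"
    define l where "l = d / (a - b)"
    have l: "l * (a - b) = d" using that by (simp add: l_def)
    have "0 \<le> l\<^sup>2 * (a - b) + K * (odd_powr a (q - 1) - odd_powr b (q - 1)) - 2 * l * d"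
      using odd_powr_auxiliary_mono[OF q less_imp_le[OF that], of l]
      unfolding K_def[symmetric] by (simp add: d_def algebra_simps)
    then have "0 \<le> (l\<^sup>2 * (a - b) + K * (odd_powr a (q - 1) - odd_powr b (q - 1)) - 2 * l * d) * (a - b)"
      using that by (intro mult_nonneg_nonneg) auto
    also have "\<dots> = K * ((odd_powr a (q - 1) - odd_powr b (q - 1)) * (a - b)) - d\<^sup>2"
      unfolding l[symmetric] by (simp add: algebra_simps power2_eq_square)
    finally show ?thesis by (simp add: d_def)
  qed
  have "(odd_powr a (q / 2) - odd_powr b (q / 2))\<^sup>2
      \<le> K * ((odd_powr a (q - 1) - odd_powr b (q - 1)) * (a - b))"
  proof (cases a b rule: linorder_cases)
    case less
    then show ?thesis using main[of a b]
      by (metis (no_types, opaque_lifting) minus_diff_eq mult_minus_left mult_minus_right power2_commute)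
  qed (use main[of b a] in auto)
  then have "4 * (q - 1) / q\<^sup>2 * (odd_powr a (q / 2) - odd_powr b (q / 2))\<^sup>2
      \<le> 4 * (q - 1) / q\<^sup>2 * (K * ((odd_powr a (q - 1) - odd_powr b (q - 1)) * (a - b)))"
    using q by (intro mult_left_mono) auto
  also have "\<dots> = (odd_powr a (q - 1) - odd_powr b (q - 1)) * (a - b)"
    using q by (simp add: K_def)
  finally show ?thesis .
qed

section \<open>The weights\<close>

text \<open>The Bochner integral of a nonnegative function is nonnegative whether or not it
  converges, and \<open>inverse\<close> preserves this.\<close>

lemma frac_const_nonneg: "0 \<le> frac_const \<theta>"
  unfolding frac_const_def by (auto intro!: Bochner_Integration.integral_nonneg)

section \<open>Derivatives of \<open>G\<close> in closed form\<close>

definition G1 :: "real \<Rightarrow> real \<Rightarrow> real" where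
  "G1 \<theta> t =
     (if 2 * \<theta> \<noteq> 1 then frac_const \<theta> / ((2 * \<theta> - 1) * (2 * \<theta>)) * t powr (1 - 2 * \<theta>)
      else - frac_const \<theta> * ln t)"

lemma has_field_derivative_G:
  assumes "0 < \<theta>" "\<theta> < 1" "0 < t"
  shows "(G \<theta> has_real_derivative G1 \<theta> t) (at t)"
proof (cases "2 * \<theta> = 1")
  case True
  have "((\<lambda>t. frac_const \<theta> * (t - t * ln t)) has_real_derivative G1 \<theta> t) (at t)"
    using assms True by (auto intro!: derivative_eq_intros simp: G1_def)
  then show ?thesis using True by (simp add: G_def[abs_def])
next
  case False
  have "((\<lambda>t. frac_const \<theta> / ((2 - 2 * \<theta>) * (2 * \<theta> - 1) * (2 * \<theta>)) * t powr (2 - 2 * \<theta>))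
      has_real_derivative frac_const \<theta> / ((2 - 2 * \<theta>) * (2 * \<theta> - 1) * (2 * \<theta>))
        * ((2 - 2 * \<theta>) * t powr (2 - 2 * \<theta> - 1))) (at t)"
    using assms by (intro DERIV_cmult has_real_derivative_powr)
  also have "frac_const \<theta> / ((2 - 2 * \<theta>) * (2 * \<theta> - 1) * (2 * \<theta>))
      * ((2 - 2 * \<theta>) * t powr (2 - 2 * \<theta> - 1)) = G1 \<theta> t"
    using assms False by (simp add: G1_def)
  finally show ?thesis using False by (simp add: G_def[abs_def])
qed

text \<open>Both cases lead to the same power of \<open>t\<close>, so the case distinction on
  \<open>2 * \<theta> = 1\<close> ends here.\<close>

lemma has_field_derivative_G1:
  assumes "0 < \<theta>" "\<theta> < 1" "0 < t"
  shows "(G1 \<theta> has_real_derivative - frac_const \<theta> / (2 * \<theta>) * t powr (- 2 * \<theta>)) (at t)"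
proof (cases "2 * \<theta> = 1")
  case True
  have "((\<lambda>t. - frac_const \<theta> * ln t) has_real_derivative - frac_const \<theta> * inverse t) (at t)"
    using assms by (auto intro!: derivative_eq_intros simp: divide_inverse)
  then show ?thesis using True assms by (simp add: G1_def[abs_def] powr_minus powr_one)
next
  case False
  have "((\<lambda>t. frac_const \<theta> / ((2 * \<theta> - 1) * (2 * \<theta>)) * t powr (1 - 2 * \<theta>))
      has_real_derivative frac_const \<theta> / ((2 * \<theta> - 1) * (2 * \<theta>))
        * ((1 - 2 * \<theta>) * t powr (1 - 2 * \<theta> - 1))) (at t)"
    using assms by (intro DERIV_cmult has_real_derivative_powr)
  also have "frac_const \<theta> / ((2 * \<theta> - 1) * (2 * \<theta>)) * ((1 - 2 * \<theta>) * t powr (1 - 2 * \<theta> - 1))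
      = - frac_const \<theta> / (2 * \<theta>) * t powr (- 2 * \<theta>)"
    using assms False by (simp add: divide_simps) (simp add: algebra_simps)
  finally show ?thesis using False by (simp add: G1_def[abs_def])
qed

lemma deriv_G: "0 < \<theta> \<Longrightarrow> \<theta> < 1 \<Longrightarrow> 0 < t \<Longrightarrow> G' \<theta> t = G1 \<theta> t"
  by (simp add: DERIV_imp_deriv has_field_derivative_G)

lemma deriv2_G:
  assumes "0 < \<theta>" "\<theta> < 1" "0 < t"
  shows "G'' \<theta> t = - frac_const \<theta> / (2 * \<theta>) * t powr (- 2 * \<theta>)"
proof -
  have "eventually (\<lambda>t. G' \<theta> t = G1 \<theta> t) (nhds t)"
    using eventually_nhds_in_open[of "{0<..}" t] assms
    by (auto elim!: eventually_mono simp: deriv_G)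
  then have "(G' \<theta> has_real_derivative - frac_const \<theta> / (2 * \<theta>) * t powr (- 2 * \<theta>)) (at t)"
    using has_field_derivative_G1[OF assms] by (subst DERIV_cong_ev[OF refl _ refl])
  then show ?thesis by (rule DERIV_imp_deriv)
qed

text \<open>
  Integrating \<open>G'''\<close> against a quadratic polynomial \<open>Q\<close> by parts: this is an antiderivative of
  \<open>G''' Q\<close>, for \<open>Q t = k (t - a) (t - b)\<close>. All weights are sums of increments of such functions,
  that is, integrals of \<open>G'''\<close> against piecewise quadratic functions.
\<close>

definition quad_primitive :: "real \<Rightarrow> real \<Rightarrow> real \<Rightarrow> real \<Rightarrow> real \<Rightarrow> real" where
  "quad_primitive \<theta> k a b t =
     G'' \<theta> t * (k * (t - a) * (t - b)) - G' \<theta> t * (k * (2 * t - a - b)) + 2 * k * G \<theta> t"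

lemma has_field_derivative_quad_primitive:
  assumes "0 < \<theta>" "\<theta> < 1" "0 < t"
  shows "(quad_primitive \<theta> k a b has_real_derivative
    frac_const \<theta> * t powr (- 1 - 2 * \<theta>) * (k * (t - a) * (t - b))) (at t)"
proof -
  let ?G2 = "\<lambda>t. - frac_const \<theta> / (2 * \<theta>) * t powr (- 2 * \<theta>)"
  let ?F = "\<lambda>t. ?G2 t * (k * (t - a) * (t - b)) - G1 \<theta> t * (k * (2 * t - a - b)) + 2 * k * G \<theta> t"
  have "(?G2 has_real_derivative - frac_const \<theta> / (2 * \<theta>) * (- 2 * \<theta> * t powr (- 2 * \<theta> - 1))) (at t)"
    using assms by (intro DERIV_cmult has_real_derivative_powr)
  also have "- frac_const \<theta> / (2 * \<theta>) * (- 2 * \<theta> * t powr (- 2 * \<theta> - 1))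
      = frac_const \<theta> * t powr (- 1 - 2 * \<theta>)"
  proof -
    have e: "- 2 * \<theta> - 1 = - 1 - 2 * \<theta>" by simp
    show ?thesis unfolding e using assms by simp
  qed
  finally have G2: "(?G2 has_real_derivative frac_const \<theta> * t powr (- 1 - 2 * \<theta>)) (at t)" .
  have "(?F has_real_derivative
    frac_const \<theta> * t powr (- 1 - 2 * \<theta>) * (k * (t - a) * (t - b))) (at t)"
    by (rule derivative_eq_intros G2 has_field_derivative_G1[OF assms]
        has_field_derivative_G[OF assms] refl)+
      (simp add: algebra_simps)
  moreover have "eventually (\<lambda>t. quad_primitive \<theta> k a b t = ?F t) (nhds t)"
    using eventually_nhds_in_open[of "{0<..}" t] assms
    by (auto elim!: eventually_mono simp: quad_primitive_def deriv_G deriv2_G)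
  ultimately show ?thesis
    by (subst DERIV_cong_ev[OF refl _ refl])
qed

text \<open>\<open>quad_primitive\<close> minus \<open>frac_const \<theta> * P\<close> has a
  nonnegative derivative. An integral is thus bounded below through an explicit antiderivative
  \<open>P\<close> of a minorant.\<close>

lemma quad_primitive_increment_ge:
  assumes "0 < \<theta>" "\<theta> < 1" "0 < x" "x \<le> y"
    and P: "\<And>t. x \<le> t \<Longrightarrow> t \<le> y \<Longrightarrow> (P has_real_derivative P' t) (at t)"
    and le: "\<And>t. x \<le> t \<Longrightarrow> t \<le> y \<Longrightarrow> P' t \<le> t powr (- 1 - 2 * \<theta>) * (k * (t - a) * (t - b))"
  shows "frac_const \<theta> * (P y - P x) \<le> quad_primitive \<theta> k a b y - quad_primitive \<theta> k a b x"
proof -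
  have "quad_primitive \<theta> k a b x - frac_const \<theta> * P x \<le> quad_primitive \<theta> k a b y - frac_const \<theta> * P y"
  proof (rule DERIV_nonneg_imp_nondecreasing[OF \<open>x \<le> y\<close>])
    fix t assume t: "x \<le> t" "t \<le> y"
    have "((\<lambda>t. quad_primitive \<theta> k a b t - frac_const \<theta> * P t) has_real_derivative
      frac_const \<theta> * t powr (- 1 - 2 * \<theta>) * (k * (t - a) * (t - b)) - frac_const \<theta> * P' t) (at t)"
      using t assms by (intro DERIV_diff DERIV_cmult P has_field_derivative_quad_primitive) auto
    moreover have "0 \<le> frac_const \<theta> * (t powr (- 1 - 2 * \<theta>) * (k * (t - a) * (t - b)) - P' t)"
      using le[OF t] frac_const_nonneg by (intro mult_nonneg_nonneg) auto
    ultimately show "\<exists>z. ((\<lambda>t. quad_primitive \<theta> k a b t - frac_const \<theta> * P t) has_real_derivative z) (at t) \<and> 0 \<le> z"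
      by (intro exI conjI) (assumption, simp add: right_diff_distrib mult.assoc)
  qed
  then show ?thesis by (simp add: algebra_simps)
qed

lemma quad_primitive_uminus: "quad_primitive \<theta> (- k) a b t = - quad_primitive \<theta> k a b t"
  by (simp add: quad_primitive_def algebra_simps)

text \<open>The density is largest at the left end \<open>x\<close>. The lower bound for
  \<open>- k\<close> with a linear comparison function gives the upper bound for
  \<open>k\<close>.\<close>

lemma quad_primitive_increment_le:
  assumes "0 < \<theta>" "\<theta> < 1" "0 < x" "x \<le> y"
    and Q: "\<And>t. x \<le> t \<Longrightarrow> t \<le> y \<Longrightarrow> \<bar>k * (t - a) * (t - b)\<bar> \<le> B"
  shows "quad_primitive \<theta> k a b y - quad_primitive \<theta> k a b x
    \<le> frac_const \<theta> * (x powr (- 1 - 2 * \<theta>) * B * (y - x))"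
proof -
  have "frac_const \<theta> * (- (x powr (- 1 - 2 * \<theta>) * B) * y - - (x powr (- 1 - 2 * \<theta>) * B) * x)
      \<le> quad_primitive \<theta> (- k) a b y - quad_primitive \<theta> (- k) a b x"
  proof (rule quad_primitive_increment_ge[OF assms(1-4)])
    fix t assume t: "x \<le> t" "t \<le> y"
    show "((\<lambda>t. - (x powr (- 1 - 2 * \<theta>) * B) * t) has_real_derivative - (x powr (- 1 - 2 * \<theta>) * B)) (at t)"
      by (auto intro!: derivative_eq_intros)
    have "t powr (- 1 - 2 * \<theta>) * (k * (t - a) * (t - b)) \<le> t powr (- 1 - 2 * \<theta>) * B"
      using Q[OF t] by (intro mult_left_mono) auto
    also have "\<dots> \<le> x powr (- 1 - 2 * \<theta>) * B"
      using order_trans[OF abs_ge_zero Q[OF t]] assms t by (intro mult_right_mono powr_mono2') auto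
    finally show "- (x powr (- 1 - 2 * \<theta>) * B) \<le> t powr (- 1 - 2 * \<theta>) * (- k * (t - a) * (t - b))"
      by simp
  qed
  then show ?thesis by (simp add: quad_primitive_uminus algebra_simps)
qed

text \<open>
  If \<open>Q\<close> changes sign at \<open>m\<close>, the density \<open>t powr (- 1 - 2 * \<theta>)\<close> may be replaced by the multiple
  of another power \<open>t powr (- e)\<close> that agrees with it at \<open>m\<close>.
\<close>

lemma powr_crossing_times:
  fixes t m e \<theta> Q :: real
  assumes "0 < t" "0 < m" and sgn: "0 \<le> (m - t) * (1 + 2 * \<theta> - e) * Q"
  shows "m powr (e - 1 - 2 * \<theta>) * (t powr (- e) * Q) \<le> t powr (- 1 - 2 * \<theta>) * Q"
proof -
  have split: "t powr (- 1 - 2 * \<theta>) = t powr (e - 1 - 2 * \<theta>) * t powr (- e)"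
    by (simp flip: powr_add)
  \<comment> \<open>By \<open>sgn\<close>, the ratio \<open>t powr (e - 1 - 2 * \<theta>)\<close> of
    the densities is at least its value at \<open>m\<close> where \<open>Q\<close> is positive, and
    at most that value where \<open>Q\<close> is negative.\<close>
  have "m powr (e - 1 - 2 * \<theta>) * Q \<le> t powr (e - 1 - 2 * \<theta>) * Q"
  proof (cases "(m - t) * (1 + 2 * \<theta> - e) = 0")
    case False
    then consider "0 < (m - t) * (1 + 2 * \<theta> - e)" "0 \<le> Q" | "(m - t) * (1 + 2 * \<theta> - e) < 0" "Q \<le> 0"
      using sgn by (metis linorder_neqE_linordered_idom zero_le_mult_iff not_less)
    then show ?thesis
    proof cases
      case 1
      then have "m powr (e - 1 - 2 * \<theta>) \<le> t powr (e - 1 - 2 * \<theta>)"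
        using assms(1,2) by (auto simp: zero_less_mult_iff intro: powr_mono2 powr_mono2')
      then show ?thesis using 1 by (intro mult_right_mono)
    next
      case 2
      then have "t powr (e - 1 - 2 * \<theta>) \<le> m powr (e - 1 - 2 * \<theta>)"
        using assms(1,2) by (auto simp: mult_less_0_iff intro: powr_mono2 powr_mono2')
      then show ?thesis using 2 by (intro mult_right_mono_neg)
    qed
  qed (use assms(1,2) in auto)
  then have "m powr (e - 1 - 2 * \<theta>) * Q * t powr (- e) \<le> t powr (e - 1 - 2 * \<theta>) * Q * t powr (- e)"
    by (rule mult_right_mono) simp
  then show ?thesis unfolding split by (simp only: mult_ac)
qed

section \<open>Lower bounds for the two halves of the odd weights\<close>

text \<open>The quadratic turns from negative to positive at \<open>m\<close>, so a faster decaying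
  density that agrees at \<open>m\<close> gives a lower bound. The exponent \<open>3\<close> serves
  all \<open>\<theta> < 1\<close> and integrates to a logarithm.\<close>

lemma quad_primitive_left_increment_ge:
  assumes "0 < \<theta>" "\<theta> < 1" "1 < m"
  shows "frac_const \<theta> * (m powr (2 - 2 * \<theta>)
        * ((ln ((m + 1) / (m - 1)) - 2 * (m\<^sup>2 + m - 1) / ((m - 1) * (m + 1)\<^sup>2)) / 2))
      \<le> quad_primitive \<theta> (1 / 2) (m - 1) m (m + 1) - quad_primitive \<theta> (1 / 2) (m - 1) m (m - 1)"
proof -
  let ?P = "\<lambda>t. m powr (2 - 2 * \<theta>) * ((ln t + (2 * m - 1) / t - (m - 1) * m / (2 * t\<^sup>2)) / 2)"
  have "frac_const \<theta> * (?P (m + 1) - ?P (m - 1))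
      \<le> quad_primitive \<theta> (1 / 2) (m - 1) m (m + 1) - quad_primitive \<theta> (1 / 2) (m - 1) m (m - 1)"
  proof (rule quad_primitive_increment_ge)
    fix t assume t: "m - 1 \<le> t" "t \<le> m + 1"
    then have pos: "0 < t" using assms by simp
    show "(?P has_real_derivative m powr (2 - 2 * \<theta>) * (1 / t ^ 3 * (1 / 2 * (t - (m - 1)) * (t - m)))) (at t)"
      using pos by (auto intro!: derivative_eq_intros simp: field_simps power2_eq_square power3_eq_cube power4_eq_xxxx)

    have "0 \<le> (m - t) * (1 + 2 * \<theta> - 3) * (1 / 2 * (t - (m - 1)) * (t - m))"
    proof -
      have "0 \<le> (m - t)\<^sup>2 * ((1 - \<theta>) * (t - (m - 1)))" using t assms by simp
      also have "\<dots> = (m - t) * (1 + 2 * \<theta> - 3) * (1 / 2 * (t - (m - 1)) * (t - m))"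
        by (simp add: field_simps power2_eq_square)
      finally show ?thesis .
    qed
    moreover have "t powr (- 3) = 1 / t ^ 3"
      using pos by (simp add: powr_minus powr_numeral divide_inverse)
    ultimately
    show "m powr (2 - 2 * \<theta>) * (1 / t ^ 3 * (1 / 2 * (t - (m - 1)) * (t - m)))
        \<le> t powr (- 1 - 2 * \<theta>) * (1 / 2 * (t - (m - 1)) * (t - m))"
      using powr_crossing_times[OF pos, of m \<theta> 3] assms by simp
  qed (use assms in auto)
  also have "?P (m + 1) - ?P (m - 1) = m powr (2 - 2 * \<theta>)
      * ((ln ((m + 1) / (m - 1)) - 2 * (m\<^sup>2 + m - 1) / ((m - 1) * (m + 1)\<^sup>2)) / 2)"
  proof -
    have "(2 * m - 1) / (m + 1) - (m - 1) * m / (2 * (m + 1)\<^sup>2)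
        - ((2 * m - 1) / (m - 1) - (m - 1) * m / (2 * (m - 1)\<^sup>2))
        = - (2 * (m\<^sup>2 + m - 1) / ((m - 1) * (m + 1)\<^sup>2))"
      using assms by (simp add: divide_simps) (simp add: algebra_simps power2_eq_square)
    moreover have "ln (m + 1) - ln (m - 1) = ln ((m + 1) / (m - 1))"
      using assms by (simp add: ln_div)
    moreover have "X * ((a + b - c) / 2) - X * ((d + e - f) / 2) = X * ((a - d + (b - c - (e - f))) / 2)"
      for X a b c d e f :: real
      by (simp add: field_simps)
    ultimately show ?thesis by simp
  qed
  finally show ?thesis .
qed

text \<open>Two terms of the series of \<open>ln ((m + 1) / (m - 1)) = 2 * artanh (1 / m)\<close>
  reduce the claim to the sign of the cubic \<open>m ^ 3 - 2 * m\<^sup>2 - m - 1\<close>.\<close>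

lemma quad_primitive_left_increment_nonneg:
  assumes "0 < \<theta>" "\<theta> < 1" "4 \<le> m"
  shows "0 \<le> quad_primitive \<theta> (1 / 2) (m - 1) m (m + 1) - quad_primitive \<theta> (1 / 2) (m - 1) m (m - 1)"
proof -
  have y: "((m + 1) / (m - 1) - 1) / ((m + 1) / (m - 1) + 1) = 1 / m"
    using assms by (simp add: divide_simps)
  have "2 / m + 2 / (3 * m ^ 3) \<le> ln ((m + 1) / (m - 1))"
    using ln_approx_bounds[of "(m + 1) / (m - 1)" 2] assms unfolding y
    by (simp add: eval_nat_numeral field_simps)
  moreover have "2 * (m\<^sup>2 + m - 1) / ((m - 1) * (m + 1)\<^sup>2) \<le> 2 / m + 2 / (3 * m ^ 3)"
  proof -
    have "0 \<le> m\<^sup>2 * (m - 4)" "0 \<le> m * (m - 4)" using assms by auto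
    moreover have "m ^ 3 - 2 * m\<^sup>2 - m - 1 = m\<^sup>2 * (m - 4) + 2 * (m * (m - 4)) + 7 * m - 1"
      by (simp add: algebra_simps power2_eq_square power3_eq_cube)
    ultimately have num: "0 \<le> m ^ 3 - 2 * m\<^sup>2 - m - 1" using assms by linarith
    have "2 / m + 2 / (3 * m ^ 3) - 2 * (m\<^sup>2 + m - 1) / ((m - 1) * (m + 1)\<^sup>2)
        = 2 * (m ^ 3 - 2 * m\<^sup>2 - m - 1) / (3 * m ^ 3 * ((m - 1) * (m + 1)\<^sup>2))"
      using assms by (simp add: divide_simps) (simp add: algebra_simps power2_eq_square power3_eq_cube)
    also have "\<dots> \<ge> 0" using num assms by (intro divide_nonneg_nonneg mult_nonneg_nonneg) auto
    finally show ?thesis by simp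
  qed
  ultimately have "0 \<le> frac_const \<theta> * (m powr (2 - 2 * \<theta>)
        * ((ln ((m + 1) / (m - 1)) - 2 * (m\<^sup>2 + m - 1) / ((m - 1) * (m + 1)\<^sup>2)) / 2))"
    using frac_const_nonneg by (intro mult_nonneg_nonneg) auto
  then show ?thesis using quad_primitive_left_increment_ge[of \<theta> m] assms by linarith
qed

text \<open>On the right half the quadratic turns from positive to negative at \<open>m\<close>, so
  the comparison density has to decay more slowly:
  \<open>e \<le> 1 < 1 + 2 * \<theta>\<close>.\<close>

lemma right_crossing_sign:
  fixes \<theta> m t e :: real
  assumes "0 < \<theta>" "e \<le> 1" "t \<le> m + 1"
  shows "0 \<le> (m - t) * (1 + 2 * \<theta> - e) * (1 / 2 * (t - m) * (t - (m + 1)))"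
proof -
  have "0 \<le> (m - t)\<^sup>2 * ((1 + 2 * \<theta> - e) * (m + 1 - t) / 2)" using assms by simp
  also have "\<dots> = (m - t) * (1 + 2 * \<theta> - e) * (1 / 2 * (t - m) * (t - (m + 1)))"
    by (simp add: field_simps power2_eq_square)
  finally show ?thesis .
qed

text \<open>The constant comparison density (\<open>e = 0\<close>) suffices: the quadratic has
  integral \<open>1 / 3\<close> over the interval.\<close>

lemma quad_primitive_right_increment_nonneg:
  assumes "0 < \<theta>" "\<theta> < 1" "1 < m"
  shows "0 \<le> quad_primitive \<theta> (1 / 2) m (m + 1) (m + 1) - quad_primitive \<theta> (1 / 2) m (m + 1) (m - 1)"
proof -
  let ?P = "\<lambda>t. m powr (0 - 1 - 2 * \<theta>) * ((t ^ 3 / 3 - (2 * m + 1) * t\<^sup>2 / 2 + m * (m + 1) * t) / 2)"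
  have "frac_const \<theta> * (?P (m + 1) - ?P (m - 1))
      \<le> quad_primitive \<theta> (1 / 2) m (m + 1) (m + 1) - quad_primitive \<theta> (1 / 2) m (m + 1) (m - 1)"
  proof (rule quad_primitive_increment_ge)
    fix t assume t: "m - 1 \<le> t" "t \<le> m + 1"
    then have pos: "0 < t" using assms by simp
    show "(?P has_real_derivative m powr (0 - 1 - 2 * \<theta>) * (1 / 2 * (t - m) * (t - (m + 1)))) (at t)"
      by (auto intro!: derivative_eq_intros simp: field_simps power2_eq_square)
    show "m powr (0 - 1 - 2 * \<theta>) * (1 / 2 * (t - m) * (t - (m + 1)))
        \<le> t powr (- 1 - 2 * \<theta>) * (1 / 2 * (t - m) * (t - (m + 1)))"
      using powr_crossing_times[OF pos _ right_crossing_sign[OF assms(1) _ t(2)], of 0] pos assms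
      by simp
  qed (use assms in auto)
  also have "?P (m + 1) - ?P (m - 1) = m powr (0 - 1 - 2 * \<theta>) / 3"
    unfolding right_diff_distrib[symmetric] by (simp add: field_simps power2_eq_square power3_eq_cube)
  finally show ?thesis
    using frac_const_nonneg by (smt (verit) divide_nonneg_nonneg mult_nonneg_nonneg powr_ge_zero)
qed

text \<open>The density \<open>1 / t\<close> gives a sharper bound than a constant one. It serves
  for \<open>j = 3\<close>, where the lower bound for the left half is negative.\<close>

lemma quad_primitive_right_increment_4_ge:
  assumes "0 < \<theta>" "\<theta> < 1"
  shows "frac_const \<theta> * (4 powr (- 2 * \<theta>) * (10 * ln (5 / 3) - 5))
    \<le> quad_primitive \<theta> (1 / 2) 4 5 5 - quad_primitive \<theta> (1 / 2) 4 5 3"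
proof -
  let ?P = "\<lambda>t::real. 4 powr (1 - 1 - 2 * \<theta>) * ((t\<^sup>2 / 2 - 9 * t + 20 * ln t) / 2)"
  have "frac_const \<theta> * (?P 5 - ?P 3)
      \<le> quad_primitive \<theta> (1 / 2) 4 5 5 - quad_primitive \<theta> (1 / 2) 4 5 3"
  proof (rule quad_primitive_increment_ge)
    fix t :: real assume t: "3 \<le> t" "t \<le> 5"
    show "(?P has_real_derivative 4 powr (1 - 1 - 2 * \<theta>) * (1 / t * (1 / 2 * (t - 4) * (t - 5)))) (at t)"
    proof (rule DERIV_cmult)
      have "((\<lambda>t. (t\<^sup>2 / 2 - 9 * t + 20 * ln t) / 2) has_real_derivative (t - 9 + 20 / t) / 2) (at t)"
        using t by (auto intro!: derivative_eq_intros simp: divide_simps)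
      also have "(t - 9 + 20 / t) / 2 = 1 / t * (1 / 2 * (t - 4) * (t - 5))"
        using t by (simp add: divide_simps) (simp add: algebra_simps)
      finally show "((\<lambda>t. (t\<^sup>2 / 2 - 9 * t + 20 * ln t) / 2) has_real_derivative
          1 / t * (1 / 2 * (t - 4) * (t - 5))) (at t)" .
    qed
    show "4 powr (1 - 1 - 2 * \<theta>) * (1 / t * (1 / 2 * (t - 4) * (t - 5)))
        \<le> t powr (- 1 - 2 * \<theta>) * (1 / 2 * (t - 4) * (t - 5))"
    proof -
      have "0 \<le> (4 - t) * (1 + 2 * \<theta> - 1) * (1 / 2 * (t - 4) * (t - 5))"
        using right_crossing_sign[of \<theta> 1 t 4] t assms by simp
      moreover have "t powr (- 1) = 1 / t"
        using t by (simp add: powr_minus powr_one divide_inverse)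
      ultimately show ?thesis
        using powr_crossing_times[of t 4 \<theta> 1 "1 / 2 * (t - 4) * (t - 5)"] t by simp
    qed
  qed (use assms in auto)
  also have "?P 5 - ?P 3 = 4 powr (- 2 * \<theta>) * (10 * ln (5 / 3) - 5)"
    by (simp add: ln_div field_simps)
  finally show ?thesis .
qed

lemma weight_pos_3_increments_nonneg:
  assumes "0 < \<theta>" "\<theta> < 1"
  shows "0 \<le> quad_primitive \<theta> (1 / 2) 1 2 3 - quad_primitive \<theta> (1 / 2) 1 2 1
    + (quad_primitive \<theta> (1 / 2) 4 5 5 - quad_primitive \<theta> (1 / 2) 4 5 3)"
proof -
  \<comment> \<open>Partial sums of the logarithm series. They must be fairly precise, since the sum
    estimated below is smaller than \<open>1 / 1000\<close>.\<close>
  have ln3: "549 / 500 \<le> ln (3::real)"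
    using ln_approx_bounds[of 3 4] by (simp add: eval_nat_numeral)
  have ln53: "1277 / 2500 \<le> ln (5 / 3 :: real)"
    using ln_approx_bounds[of "5 / 3" 3] by (simp add: eval_nat_numeral)
  \<comment> \<open>As \<open>2 - 2 * \<theta>\<close> is nonnegative, this compares the prefactors
    of the two halves uniformly in \<open>\<theta>\<close>.\<close>
  have "(2::real) powr (- 2 * \<theta> + 2) \<le> 4 powr (- 2 * \<theta> + 2)"
    using assms by (intro powr_mono2) auto
  then have pw: "2 powr (2 - 2 * \<theta>) / 16 \<le> (4::real) powr (- 2 * \<theta>)"
    using powr_add[of "4::real" "- 2 * \<theta>" 2] by (simp add: add.commute)
  have "0 \<le> (ln 3 - 10 / 9) / 2 + (10 * ln (5 / 3) - 5) / (16::real)"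
  proof -
    have "0 \<le> (x - 10 / 9) / 2 + (10 * y - 5) / 16" if "549 / 500 \<le> x" "1277 / 2500 \<le> y" for x y :: real
      using that by (simp add: field_simps)
    then show ?thesis using ln3 ln53 by blast
  qed
  then have "0 \<le> 2 powr (2 - 2 * \<theta>) * ((ln 3 - 10 / 9) / 2 + (10 * ln (5 / 3) - 5) / 16)"
    by (intro mult_nonneg_nonneg) auto
  also have "\<dots> = 2 powr (2 - 2 * \<theta>) * ((ln 3 - 10 / 9) / 2)
      + 2 powr (2 - 2 * \<theta>) / 16 * (10 * ln (5 / 3) - 5)"
    by (simp add: algebra_simps)
  also have "\<dots> \<le> 2 powr (2 - 2 * \<theta>) * ((ln 3 - 10 / 9) / 2) + 4 powr (- 2 * \<theta>) * (10 * ln (5 / 3) - 5)"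
    using pw ln53 by (intro add_left_mono mult_right_mono) auto
  finally have "0 \<le> frac_const \<theta> * \<dots>"
    using frac_const_nonneg by (intro mult_nonneg_nonneg)
  also have "\<dots> = frac_const \<theta> * (2 powr (2 - 2 * \<theta>) * ((ln 3 - 10 / 9) / 2))
      + frac_const \<theta> * (4 powr (- 2 * \<theta>) * (10 * ln (5 / 3) - 5))"
    by (rule distrib_left)
  also have "\<dots> \<le> quad_primitive \<theta> (1 / 2) 1 2 3 - quad_primitive \<theta> (1 / 2) 1 2 1
    + (quad_primitive \<theta> (1 / 2) 4 5 5 - quad_primitive \<theta> (1 / 2) 4 5 3)"
    using quad_primitive_left_increment_ge[of \<theta> 2] assms
    by (intro add_mono quad_primitive_right_increment_4_ge) simp_all
  finally show ?thesis .
qed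

section \<open>Integral representation, sign and decay of the weights\<close>

text \<open>The nodal function is \<open>1 - (t - j)\<^sup>2\<close> on
  \<open>[j - 1, j + 1]\<close>; it vanishes at both ends, so no \<open>G''\<close> appears.\<close>

lemma weight_pos_even:
  assumes "even j" "2 \<le> j"
  shows "weight_pos \<theta> h j = h powr (- (2 * \<theta>)) *
    (quad_primitive \<theta> (- 1) (real j - 1) (real j + 1) (real j + 1)
     - quad_primitive \<theta> (- 1) (real j - 1) (real j + 1) (real j - 1))"
  using assms by (auto simp: weight_pos_def quad_primitive_def algebra_simps)

text \<open>Only the right half of an odd nodal function occurs; its value \<open>1\<close> at
  \<open>t = 1\<close> produces the term \<open>- G'' \<theta> 1\<close>.\<close>

lemma weight_pos_1:
  "weight_pos \<theta> h 1 = h powr (- (2 * \<theta>)) *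
    (frac_const \<theta> / (2 - 2 * \<theta>) + (quad_primitive \<theta> (1 / 2) 2 3 3 - quad_primitive \<theta> (1 / 2) 2 3 1))"
  by (simp add: weight_pos_def quad_primitive_def field_simps)

text \<open>The halves on \<open>[j - 2, j]\<close> and \<open>[j, j + 2]\<close> both take the
  value \<open>1\<close> at \<open>j\<close> and \<open>0\<close> at the outer end, so the
  \<open>G''\<close> terms cancel.\<close>

lemma weight_pos_odd:
  assumes "odd j" "3 \<le> j"
  defines "x \<equiv> real j"
  shows "weight_pos \<theta> h j = h powr (- (2 * \<theta>)) *
    (quad_primitive \<theta> (1 / 2) (x - 2) (x - 1) x - quad_primitive \<theta> (1 / 2) (x - 2) (x - 1) (x - 2)
     + (quad_primitive \<theta> (1 / 2) (x + 1) (x + 2) (x + 2) - quad_primitive \<theta> (1 / 2) (x + 1) (x + 2) x))"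
  using assms by (auto simp: weight_pos_def quad_primitive_def field_simps)

text \<open>For odd \<open>j \<ge> 5\<close> each half is nonnegative by itself, with sign changes
  at \<open>j - 1 \<ge> 4\<close> and \<open>j + 1\<close>; for \<open>j = 3\<close> the right half
  compensates the left one. For even \<open>j\<close> the nodal function is nonnegative.\<close>

lemma weight_pos_nonneg:
  assumes "0 < \<theta>" "\<theta> < 1"
  shows "0 \<le> weight_pos \<theta> h j"
proof -
  have "j = 0 \<or> j = 1 \<or> j = 3 \<or> (even j \<and> 2 \<le> j) \<or> (odd j \<and> 5 \<le> j)"
    by presburger
  then consider "j = 0" | "j = 1" | "j = 3" | "even j" "2 \<le> j" | "odd j" "5 \<le> j"
    by blast
  then show ?thesis
  proof cases
    case 1
    then show ?thesis by (simp add: weight_pos_def)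
  next
    case 2
    have "0 \<le> frac_const \<theta> / (2 - 2 * \<theta>)"
      using assms frac_const_nonneg by simp
    then show ?thesis
      unfolding 2 weight_pos_1 using quad_primitive_right_increment_nonneg[of \<theta> 2] assms
      by (intro mult_nonneg_nonneg add_nonneg_nonneg) auto
  next
    case 3
    then show ?thesis
      using weight_pos_3_increments_nonneg[OF assms] weight_pos_odd[of j] by simp
  next
    case 4
    have "frac_const \<theta> * (0 - 0) \<le> quad_primitive \<theta> (- 1) (real j - 1) (real j + 1) (real j + 1)
     - quad_primitive \<theta> (- 1) (real j - 1) (real j + 1) (real j - 1)"
    proof (rule quad_primitive_increment_ge)
      fix t assume t: "real j - 1 \<le> t" "t \<le> real j + 1"
      show "((\<lambda>t. 0) has_real_derivative 0) (at t)" by simp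
      have "0 \<le> (t - (real j - 1)) * (real j + 1 - t)" using t by simp
      also have "\<dots> = - 1 * (t - (real j - 1)) * (t - (real j + 1))"
        by (simp add: algebra_simps)
      finally show "0 \<le> t powr (- 1 - 2 * \<theta>) * (- 1 * (t - (real j - 1)) * (t - (real j + 1)))"
        by (rule mult_nonneg_nonneg[OF powr_ge_zero])
    qed (use assms 4 in auto)
    then show ?thesis unfolding weight_pos_even[OF 4] by simp
  next
    case 5
    then have *: "weight_pos \<theta> h j = h powr (- (2 * \<theta>)) *
    (quad_primitive \<theta> (1 / 2) (real j - 2) (real j - 1) j - quad_primitive \<theta> (1 / 2) (real j - 2) (real j - 1) (real j - 2)
     + (quad_primitive \<theta> (1 / 2) (real j + 1) (real j + 2) (real j + 2) - quad_primitive \<theta> (1 / 2) (real j + 1) (real j + 2) j))"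
      using weight_pos_odd by simp
    show ?thesis
      unfolding * using quad_primitive_left_increment_nonneg[of \<theta> "real j - 1"] quad_primitive_right_increment_nonneg[of \<theta> "real j + 1"] assms 5
      by (intro mult_nonneg_nonneg add_nonneg_nonneg) (auto simp: algebra_simps)
  qed
qed

text \<open>The support has length at most \<open>4\<close>, the nodal function is at most
  \<open>1\<close> in absolute value, and the density is at most its value at \<open>j - 2\<close>,
  which is positive for \<open>j \<ge> 3\<close>.\<close>

lemma weight_pos_le:
  assumes "0 < \<theta>" "\<theta> < 1" "3 \<le> j"
  shows "weight_pos \<theta> h j \<le> h powr (- (2 * \<theta>)) * (frac_const \<theta> * (4 * (real j - 2) powr (- 1 - 2 * \<theta>)))"
proof (cases "even j")
  case True
  have "quad_primitive \<theta> (- 1) (real j - 1) (real j + 1) (real j + 1)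
     - quad_primitive \<theta> (- 1) (real j - 1) (real j + 1) (real j - 1)
     \<le> frac_const \<theta> * ((real j - 1) powr (- 1 - 2 * \<theta>) * 1 * (real j + 1 - (real j - 1)))"
  proof (rule quad_primitive_increment_le)
    fix t assume "real j - 1 \<le> t" "t \<le> real j + 1"
    then have "\<bar>t - real j\<bar> \<le> 1" by simp
    then have "(t - real j)\<^sup>2 \<le> 1" by (simp add: abs_square_le_1)
    moreover have "- 1 * (t - (real j - 1)) * (t - (real j + 1)) = 1 - (t - real j)\<^sup>2"
      by (simp add: algebra_simps power2_eq_square)
    ultimately show "\<bar>- 1 * (t - (real j - 1)) * (t - (real j + 1))\<bar> \<le> 1"
      by (smt (verit) zero_le_power2)
  qed (use assms in auto)
  also have "\<dots> \<le> frac_const \<theta> * (4 * (real j - 2) powr (- 1 - 2 * \<theta>))"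
  proof (rule mult_left_mono[OF _ frac_const_nonneg])
    have "(real j - 1) powr (- 1 - 2 * \<theta>) \<le> (real j - 2) powr (- 1 - 2 * \<theta>)"
      using assms by (intro powr_mono2') auto
    moreover have "real j + 1 - (real j - 1) = 2" by simp
    ultimately show "(real j - 1) powr (- 1 - 2 * \<theta>) * 1 * (real j + 1 - (real j - 1))
        \<le> 4 * (real j - 2) powr (- 1 - 2 * \<theta>)"
      using powr_ge_zero[of "real j - 2" "- 1 - 2 * \<theta>"] by (simp only: mult_1_right)
  qed
  finally show ?thesis
    using assms True by (subst weight_pos_even) (auto intro!: mult_left_mono)
next
  case False
  \<comment> \<open>The range \<open>[- 1, 2]\<close> covers both halves: \<open>r\<close> is the
    distance from the first root, in \<open>[0, 2]\<close> on the left and in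
    \<open>[- 1, 1]\<close> on the right.\<close>
  have quad: "\<bar>1 / 2 * r * (r - 1)\<bar> \<le> 1" if "- 1 \<le> r" "r \<le> 2" for r :: real
  proof -
    have "0 \<le> (2 - r) * (1 + r)" using that by simp
    moreover have "0 \<le> (r - 1 / 2)\<^sup>2" by simp
    ultimately show ?thesis by (simp add: abs_le_iff algebra_simps power2_eq_square)
  qed
  have l: "quad_primitive \<theta> (1 / 2) (real j - 2) (real j - 1) j - quad_primitive \<theta> (1 / 2) (real j - 2) (real j - 1) (real j - 2)
     \<le> frac_const \<theta> * ((real j - 2) powr (- 1 - 2 * \<theta>) * 1 * (real j - (real j - 2)))"
  proof (rule quad_primitive_increment_le)
    fix t assume "real j - 2 \<le> t" "t \<le> real j"
    then show "\<bar>1 / 2 * (t - (real j - 2)) * (t - (real j - 1))\<bar> \<le> 1"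
      using quad[of "t - (real j - 2)"] by (simp add: algebra_simps)
  qed (use assms in auto)
  have "quad_primitive \<theta> (1 / 2) (real j + 1) (real j + 2) (real j + 2) - quad_primitive \<theta> (1 / 2) (real j + 1) (real j + 2) j
     \<le> frac_const \<theta> * (real j powr (- 1 - 2 * \<theta>) * 1 * (real j + 2 - real j))"
  proof (rule quad_primitive_increment_le)
    fix t assume "real j \<le> t" "t \<le> real j + 2"
    then show "\<bar>1 / 2 * (t - (real j + 1)) * (t - (real j + 2))\<bar> \<le> 1"
      using quad[of "t - (real j + 1)"] by (simp add: algebra_simps)
  qed (use assms in auto)
  also have "\<dots> \<le> frac_const \<theta> * (2 * (real j - 2) powr (- 1 - 2 * \<theta>))"
    using assms powr_mono2'[of "- 1 - 2 * \<theta>" "real j - 2" "real j"] frac_const_nonneg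
    by (intro mult_left_mono) auto
  finally show ?thesis
    using assms False l by (subst weight_pos_odd) (auto intro!: mult_left_mono)
qed

lemma summable_weight_pos:
  assumes "0 < \<theta>" "\<theta> < 1"
  shows "summable (weight_pos \<theta> h)"
proof -
  \<comment> \<open>With \<open>j = n + 3\<close> the base \<open>j - 2\<close> becomes
    \<open>Suc n\<close>, and the exponent is below \<open>- 1\<close>.\<close>
  have "summable (\<lambda>n. h powr (- (2 * \<theta>)) * (frac_const \<theta> * (4 * real (Suc n) powr (- 1 - 2 * \<theta>))))"
    using assms by (intro summable_mult) (simp add: summable_Suc_iff[of "\<lambda>n. real n powr _"] summable_real_powr_iff del: of_nat_Suc)
  then have "summable (\<lambda>n. weight_pos \<theta> h (n + 3))"
    by (rule summable_comparison_test_ev[rotated])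
      (use weight_pos_le[OF assms, of "_ + 3"] weight_pos_nonneg[OF assms] in
        \<open>auto intro!: always_eventually simp: add.commute\<close>)
  then show ?thesis by (simp only: summable_iff_shift)
qed

lemma weight_nonneg: "0 < \<theta> \<Longrightarrow> \<theta> < 1 \<Longrightarrow> 0 \<le> weight \<theta> h j"
  by (simp add: weight_def weight_pos_nonneg)

lemma weight_minus: "weight \<theta> h (- j) = weight \<theta> h j"
  by (simp add: weight_def)

lemma weight_summable_on:
  assumes "0 < \<theta>" "\<theta> < 1"
  shows "weight \<theta> h summable_on UNIV"
proof -
  have "weight_pos \<theta> h summable_on UNIV"
    using summable_weight_pos[OF assms] weight_pos_nonneg[OF assms]
    by (intro norm_summable_imp_summable_on) simp
  then have "weight \<theta> h summable_on range int" "weight \<theta> h summable_on range (\<lambda>n. - int n)"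
    by (subst summable_on_reindex; auto simp: inj_on_def o_def weight_def)+
  moreover have "range int \<union> range (\<lambda>n. - int n) = UNIV"
    by (auto, metis int_cases2 rangeI)
  ultimately show ?thesis using summable_on_union by metis
qed

section \<open>The quadratic form and the implicit step\<close>

text \<open>Induction over the rows reduces the double sum to finitely many single sums; products
  with a factor \<open>f i\<close>, \<open>f\<close> a grid function, are of this kind.\<close>

lemma has_sum_finitely_many_rows:
  fixes g :: "'a \<Rightarrow> 'b \<Rightarrow> real"
  assumes "finite S" "\<And>i. i \<in> S \<Longrightarrow> (g i has_sum s i) UNIV" "\<And>i j. i \<notin> S \<Longrightarrow> g i j = 0"
  shows "((\<lambda>(i, j). g i j) has_sum (\<Sum>i\<in>S. s i)) UNIV"
proof -
  have "((\<lambda>(i, j). if i \<in> S then g i j else 0) has_sum (\<Sum>i\<in>S. s i)) UNIV"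
    using assms(1,2)
  proof (induction S rule: finite_induct)
    case (insert k S)
    have "((\<lambda>(i, j). g i j) has_sum s k) (Pair k ` UNIV)"
      using insert.prems by (subst has_sum_reindex) (auto simp: inj_on_def o_def)
    then have "((\<lambda>(i, j). if i = k then g i j else 0) has_sum s k) UNIV"
      by (subst has_sum_cong_neutral[where S = "Pair k ` UNIV" and f = "\<lambda>(i, j). g i j", symmetric]) auto
    from has_sum_add[OF this insert.IH] insert.prems
    have "((\<lambda>x. (case x of (i, j) \<Rightarrow> if i = k then g i j else 0)
        + (case x of (i, j) \<Rightarrow> if i \<in> S then g i j else 0)) has_sum (s k + (\<Sum>i\<in>S. s i))) UNIV"
      by simp
    also have "(\<lambda>x. (case x of (i, j) \<Rightarrow> if i = k then g i j else 0)
        + (case x of (i, j) \<Rightarrow> if i \<in> S then g i j else 0))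
      = (\<lambda>(i, j). if i \<in> insert k S then g i j else 0)"
      using insert.hyps by (auto simp: fun_eq_iff)
    finally show ?case using insert.hyps by simp
  qed (simp add: case_prod_unfold)
  also have "(\<lambda>(i, j). if i \<in> S then g i j else 0) = (\<lambda>(i, j). g i j)"
    using assms(3) by (auto simp: fun_eq_iff)
  finally show ?thesis .
qed

lemma has_sum_diff:
  fixes f g :: "'a \<Rightarrow> 'b::real_normed_vector"
  assumes "(f has_sum a) A" "(g has_sum b) A"
  shows "((\<lambda>x. f x - g x) has_sum (a - b)) A"
  using has_sum_add[OF assms(1), of "\<lambda>x. - g x" "- b"] assms(2) by (simp add: has_sum_uminus)

section \<open>The symmetric form of the Laplacian on grid functions\<close>

locale fractional_grid =
  fixes \<theta> h :: real and M :: nat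
  assumes theta: "0 < \<theta>" "\<theta> < 1" and h_pos: "0 < h"
begin

abbreviation grid :: "int set" where "grid \<equiv> {- int M..int M}"

abbreviation w :: "int \<Rightarrow> real" where "w \<equiv> weight \<theta> h"

abbreviation Lap :: "(int \<Rightarrow> real) \<Rightarrow> int \<Rightarrow> real" where "Lap \<equiv> frac_laplacian \<theta> h"

definition supported :: "(int \<Rightarrow> real) \<Rightarrow> bool" where
  "supported f \<longleftrightarrow> (\<forall>i. i \<notin> grid \<longrightarrow> f i = 0)"

definition total_weight :: real where
  "total_weight = infsum w UNIV"

text \<open>The pairing without the factor \<open>h\<close>; for a grid function \<open>f\<close>,
  \<open>h * form f f\<close> is the squared \<open>X_norm\<close>.\<close>

definition form :: "(int \<Rightarrow> real) \<Rightarrow> (int \<Rightarrow> real) \<Rightarrow> real" where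
  "form f g = (\<Sum>i\<in>grid. f i * Lap g i)"

lemma supportedD: "supported f \<Longrightarrow> i \<notin> grid \<Longrightarrow> f i = 0"
  by (simp add: supported_def)

lemma supported_diff: "supported f \<Longrightarrow> supported g \<Longrightarrow> supported (\<lambda>i. f i - g i)"
  by (simp add: supported_def)

lemma has_sum_weight: "(w has_sum total_weight) UNIV"
  unfolding total_weight_def using weight_summable_on[OF theta] by (rule has_sum_infsum)

lemma has_sum_weight_shift:
  assumes "supported f"
  shows "((\<lambda>j. w j * f (i - j)) has_sum (\<Sum>k\<in>grid. w (i - k) * f k)) UNIV"
proof (rule has_sum_finite_neutralI[where B = "(\<lambda>k. i - k) ` grid"])
  fix j assume "j \<in> UNIV - (\<lambda>k. i - k) ` grid"
  then have "i - j \<notin> grid" by (metis DiffD2 diff_diff_eq2 add_diff_cancel_left' image_eqI)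
  then show "w j * f (i - j) = 0" using supportedD[OF assms] by simp
next
  show "(\<Sum>k\<in>grid. w (i - k) * f k) = (\<Sum>j\<in>(\<lambda>k. i - k) ` grid. w j * f (i - j))"
    by (subst sum.reindex) (auto simp: inj_on_def)
qed auto

text \<open>Summability of the weights allows the series to be split, so that \<open>Lap\<close>
  acts on grid functions as a finite matrix.\<close>

lemma Lap_eq:
  assumes "supported f"
  shows "Lap f i = total_weight * f i - (\<Sum>k\<in>grid. w (i - k) * f k)"
proof -
  have "((\<lambda>j. w j * f i - w j * f (i - j)) has_sum
      (total_weight * f i - (\<Sum>k\<in>grid. w (i - k) * f k))) UNIV"
    by (intro has_sum_diff has_sum_cmult_left has_sum_weight has_sum_weight_shift assms)
  then show ?thesis
    unfolding frac_laplacian_def by (simp add: right_diff_distrib infsumI)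
qed

lemma Lap_diff:
  assumes "supported f" "supported g"
  shows "Lap (\<lambda>i. f i - g i) i = Lap f i - Lap g i"
  by (simp add: Lap_eq supported_diff assms right_diff_distrib sum_subtractf)

lemma Lap_minus:
  assumes "supported f"
  shows "Lap (\<lambda>i. - f i) i = - Lap f i"
  using Lap_diff[of "\<lambda>_. 0" f] assms by (simp add: supported_def frac_laplacian_def)

text \<open>Discrete maximum principle: since the weights are nonnegative, so is every term of the
  series.\<close>

lemma Lap_nonneg_at_max:
  assumes "\<And>k. f k \<le> f i"
  shows "0 \<le> Lap f i"
  unfolding frac_laplacian_def
  using assms by (intro infsum_nonneg mult_nonneg_nonneg weight_nonneg theta) simp

lemma form_eq:
  assumes "supported g"
  shows "form f g = total_weight * (\<Sum>i\<in>grid. f i * g i) - (\<Sum>i\<in>grid. \<Sum>k\<in>grid. w (i - k) * (f i * g k))"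
  unfolding form_def Lap_eq[OF assms]
  by (simp add: right_diff_distrib sum_subtractf sum_distrib_left mult_ac)

lemma form_commute:
  assumes "supported f" "supported g"
  shows "form f g = form g f"
proof -
  have "(\<Sum>i\<in>grid. \<Sum>k\<in>grid. w (i - k) * (f i * g k)) = (\<Sum>k\<in>grid. \<Sum>i\<in>grid. w (i - k) * (f i * g k))"
    by (rule sum.swap)
  also have "\<dots> = (\<Sum>k\<in>grid. \<Sum>i\<in>grid. w (k - i) * (g k * f i))"
  proof -
    have "w (i - k) * (f i * g k) = w (k - i) * (g k * f i)" for i k
      using weight_minus[of \<theta> h "i - k"] by simp
    then show ?thesis by (simp only:)
  qed
  finally show ?thesis by (simp add: form_eq assms mult.commute)
qed

lemma form_diff_left: "form (\<lambda>i. f i - g i) k = form f k - form g k"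
  by (simp add: form_def left_diff_distrib sum_subtractf)

lemma form_diff_right:
  "supported g \<Longrightarrow> supported k \<Longrightarrow> form f (\<lambda>i. g i - k i) = form f g - form f k"
  by (simp add: form_def Lap_diff right_diff_distrib sum_subtractf)

text \<open>Expand the square: both pure squares sum to \<open>s\<close> and the mixed term to
  \<open>t\<close>.\<close>

lemma has_sum_form:
  assumes "supported f"
  shows "((\<lambda>(i, j). h * w j * \<bar>f i - f (i - j)\<bar>\<^sup>2) has_sum (2 * (h * form f f))) UNIV"
proof -
  define s where "s = total_weight * (\<Sum>i\<in>grid. f i * f i)"
  define t where "t = (\<Sum>i\<in>grid. \<Sum>k\<in>grid. w (i - k) * (f i * f k))"
  have a: "((\<lambda>(i, j). w j * (f i * f i)) has_sum s) UNIV"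
    unfolding s_def sum_distrib_left
    by (rule has_sum_finitely_many_rows) (auto intro!: has_sum_cmult_left has_sum_weight simp: supportedD[OF assms])
  \<comment> \<open>This family can have infinitely many nonzero rows; the shear
    \<open>(i, j) \<mapsto> (i - j, j)\<close> carries it to the previous one.\<close>
  then have b: "((\<lambda>(i, j). w j * (f (i - j) * f (i - j))) has_sum s) UNIV"
    by (subst has_sum_reindex_bij_witness[where i = "\<lambda>(i, j). (i + j, j)" and j = "\<lambda>(i, j). (i - j, j)"
          and T = UNIV and h = "\<lambda>(i, j). w j * (f i * f i)" and s' = s]) auto
  have "((\<lambda>j. w j * (f i * f (i - j))) has_sum (\<Sum>k\<in>grid. w (i - k) * (f i * f k))) UNIV" for i
    using has_sum_cmult_right[OF has_sum_weight_shift[OF assms, of i], of "f i"]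
    by (simp add: sum_distrib_left mult_ac)
  then have c: "((\<lambda>(i, j). w j * (f i * f (i - j))) has_sum t) UNIV"
    unfolding t_def by (intro has_sum_finitely_many_rows) (auto simp: supportedD[OF assms])
  from has_sum_cmult_right[OF has_sum_diff[OF has_sum_add[OF a b] has_sum_cmult_right[OF c, of 2]], of h]
  have "((\<lambda>(i, j). h * w j * \<bar>f i - f (i - j)\<bar>\<^sup>2) has_sum (h * (s + s - 2 * t))) UNIV"
    by (simp add: case_prod_unfold power2_eq_square algebra_simps)
  then show ?thesis by (simp add: form_eq assms s_def t_def algebra_simps)
qed

lemma form_nonneg:
  assumes "supported f"
  shows "0 \<le> form f f"
proof -
  have "0 \<le> 2 * (h * form f f)"
    by (rule has_sum_nonneg[OF has_sum_form[OF assms]])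
      (use h_pos in \<open>auto simp: weight_nonneg[OF theta]\<close>)
  then show ?thesis using h_pos by (simp add: zero_le_mult_iff)
qed

lemma X_norm_squared:
  assumes "supported f"
  shows "(X_norm \<theta> h f)\<^sup>2 = h * form f f"
  using infsumI[OF has_sum_form[OF assms]] form_nonneg[OF assms] h_pos by (simp add: X_norm_def)

lemma infsum_supported:
  assumes "supported f" "0 < q"
  shows "(\<Sum>\<^sub>\<infinity>i\<in>UNIV. h * \<bar>f i\<bar> powr q) = h * (\<Sum>i\<in>grid. \<bar>f i\<bar> powr q)"
  unfolding sum_distrib_left
  by (rule infsumI, rule has_sum_finite_neutralI[where B = grid]) (auto simp: supportedD[OF assms(1)])

lemma lq_norm_powr:
  assumes "supported f" "0 < q"
  shows "lq_norm h q f powr q = h * (\<Sum>i\<in>grid. \<bar>f i\<bar> powr q)"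
  unfolding lq_norm_def infsum_supported[OF assms]
  using assms h_pos by (simp add: powr_powr sum_nonneg)

lemma l2_norm_squared:
  assumes "supported f"
  shows "(lq_norm h 2 f)\<^sup>2 = h * (\<Sum>i\<in>grid. (f i)\<^sup>2)"
proof -
  have "(lq_norm h 2 f)\<^sup>2 = lq_norm h 2 f powr 2"
    by (simp add: lq_norm_def)
  also have "\<dots> = h * (\<Sum>i\<in>grid. \<bar>f i\<bar> powr 2)"
    using assms by (intro lq_norm_powr) auto
  finally show ?thesis by simp
qed

section \<open>Existence and uniqueness for one implicit step\<close>

text \<open>
  A minimiser of the energy over a large box solves the nonlinear equation: by the maximum
  principle it does not touch the boundary of the box.
\<close>

lemma resolvent_exists:
  assumes q: "1 < q" and dt: "0 < dt"
  shows "\<exists>x. supported x \<and> (\<forall>i\<in>grid. odd_powr (x i) (q - 1) + dt * Lap x i = b i)"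
proof -
  \<comment> \<open>The box size is chosen so that \<open>R powr (q - 1)\<close> strictly exceeds
    every \<open>\<bar>b i\<bar>\<close>.\<close>
  define R where "R = (1 + (\<Sum>i\<in>grid. \<bar>b i\<bar>)) powr (1 / (q - 1))"
  have sum_b: "0 \<le> (\<Sum>i\<in>grid. \<bar>b i\<bar>)" by (simp add: sum_nonneg)
  then have pos: "0 < 1 + (\<Sum>i\<in>grid. \<bar>b i\<bar>)" by linarith
  then have R: "0 < R" "odd_powr R (q - 1) = 1 + (\<Sum>i\<in>grid. \<bar>b i\<bar>)"
    using q by (auto simp: R_def odd_powr_of_nonneg powr_powr)
  have b_less: "\<bar>b i\<bar> < odd_powr R (q - 1)" if "i \<in> grid" for i
    unfolding R using member_le_sum[OF that, of "\<lambda>i. \<bar>b i\<bar>"] by simp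
  \<comment> \<open>Pinning the coordinates outside the grid to \<open>0\<close> makes the box
    compact in the product topology on all of \<open>int \<Rightarrow> real\<close>.\<close>
  define K where "K = PiE UNIV (\<lambda>i. if i \<in> grid then {- R..R} else {0})"
  have K: "x \<in> K \<longleftrightarrow> supported x \<and> (\<forall>i\<in>grid. - R \<le> x i \<and> x i \<le> R)" for x
    by (auto simp: K_def PiE_def Pi_iff supported_def extensional_def split: if_splits)
  define E where "E x = (\<Sum>i\<in>grid. \<bar>x i\<bar> powr q / q) + dt / 2 * form x x - (\<Sum>i\<in>grid. b i * x i)" for x
  have "compactin (product_topology (\<lambda>_. euclidean) UNIV) K"
    unfolding K_def by (subst compactin_PiE) auto
  then have "compact K"
    by (simp add: euclidean_product_topology)
  moreover have "(\<lambda>_. 0) \<in> K" using R by (auto simp: K supported_def)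
  moreover have "continuous_on K E"
  proof -
    have coord: "continuous_on K (\<lambda>x. x i)" for i :: int
      by (rule continuous_on_subset[OF continuous_on_product_coordinates]) simp
    have "continuous_on K (\<lambda>x. (\<Sum>i\<in>grid. \<bar>x i\<bar> powr q / q) + dt / 2 * (total_weight * (\<Sum>i\<in>grid. x i * x i)
        - (\<Sum>i\<in>grid. \<Sum>k\<in>grid. w (i - k) * (x i * x k))) - (\<Sum>i\<in>grid. b i * x i))"
      using q by (intro continuous_intros coord continuous_on_powr') auto
    then show ?thesis
      by (rule continuous_on_eq) (simp add: E_def K form_eq)
  qed
  ultimately obtain x where x: "x \<in> K" "\<And>y. y \<in> K \<Longrightarrow> E x \<le> E y"
    using continuous_attains_inf[of K E] by auto
  then have supp: "supported x" and box: "\<And>i. i \<in> grid \<Longrightarrow> - R \<le> x i \<and> x i \<le> R"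
    by (auto simp: K)
  have bounds: "- R \<le> x k" "x k \<le> R" for k
    using box[of k] supportedD[OF supp, of k] R by (cases "k \<in> grid"; simp)+
  have "odd_powr (x i) (q - 1) + dt * Lap x i = b i" if i: "i \<in> grid" for i
  proof -
    define e where "e = (\<lambda>j. if j = i then 1 else 0 :: real)"
    have e: "supported e" using i by (auto simp: e_def supported_def)
    have form_e: "form e g = Lap g i" for g
      using i by (simp add: form_def e_def if_distrib[of "\<lambda>c. c * _"] cong: if_cong)
    \<comment> \<open>\<open>k (x i)\<close> is the residual of the equation at \<open>i\<close>.
      Convexity, used at the new value \<open>t\<close>, bounds the energy increment by
      \<open>(t - x i) * k t\<close>, so minimality makes this product nonnegative.\<close>
    define k where "k t = odd_powr t (q - 1) + dt * Lap x i + dt / 2 * (t - x i) * form e e - b i" for t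
    have key: "0 \<le> (t - x i) * k t" if t: "- R \<le> t" "t \<le> R" for t
    proof -
      define d where "d = t - x i"
      define y where "y = x(i := t)"
      have y: "y = (\<lambda>j. x j - (- d) * e j)" by (auto simp: y_def e_def d_def fun_eq_iff)
      have "y \<in> K" using x(1) t i by (auto simp: K y_def supported_def)
      then have "E x \<le> E y" by (rule x(2))
      have de: "supported (\<lambda>j. (- d) * e j)" using e by (simp add: supported_def)
      have scale: "form (\<lambda>j. (- d) * e j) g = (- d) * form e g" for g
        by (simp add: form_def sum_distrib_left mult.assoc)
      have "form y y = form x x + 2 * d * Lap x i + d\<^sup>2 * form e e"
        unfolding y form_diff_left form_diff_right[OF supp de] form_commute[OF supp de]
          scale form_commute[OF e de] form_e[of x]
        by (simp add: algebra_simps power2_eq_square)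
      moreover have "(\<Sum>j\<in>grid. \<bar>y j\<bar> powr q / q) - (\<Sum>j\<in>grid. \<bar>x j\<bar> powr q / q) = \<bar>t\<bar> powr q / q - \<bar>x i\<bar> powr q / q"
        using i by (simp add: y_def sum.remove)
      moreover have "(\<Sum>j\<in>grid. b j * y j) - (\<Sum>j\<in>grid. b j * x j) = b i * d"
        using i by (simp add: y_def sum.remove d_def right_diff_distrib)
      ultimately have "0 \<le> \<bar>t\<bar> powr q / q - \<bar>x i\<bar> powr q / q + dt / 2 * (2 * d * Lap x i + d\<^sup>2 * form e e) - b i * d"
        using \<open>E x \<le> E y\<close> unfolding E_def by (simp add: algebra_simps)
      also have "\<dots> \<le> odd_powr t (q - 1) * (t - x i) + dt / 2 * (2 * d * Lap x i + d\<^sup>2 * form e e) - b i * d"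
        using odd_powr_convexity(3)[OF q, of t "x i"] by simp
      also have "\<dots> = (t - x i) * k t"
        by (simp add: k_def d_def field_simps power2_eq_square)
      finally show ?thesis .
    qed
    have "continuous_on UNIV k"
      unfolding k_def using q by (intro continuous_intros) auto
    then have cont: "(k \<longlongrightarrow> k (x i)) (at (x i) within T)" for T
      by (metis continuous_on_def UNIV_I tendsto_within_subset subset_UNIV)
    \<comment> \<open>Dividing by \<open>t - x i < 0\<close> and letting \<open>t\<close> tend to
      \<open>x i\<close> from the left, which requires room below \<open>x i\<close> in the
      box.\<close>
    have le: "k (x i) \<le> 0" if "- R < x i"
    proof (rule tendsto_upperbound[OF cont])
      show "eventually (\<lambda>t. k t \<le> 0) (at_left (x i))"
        using eventually_at_left_real[OF that]
      proof eventually_elim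
        case (elim t)
        then have "- R \<le> t" "t \<le> R" "t - x i < 0" using bounds(2)[of i] by auto
        then show ?case using key[of t] by (simp add: zero_le_mult_iff)
      qed
    qed simp
    have ge: "0 \<le> k (x i)" if "x i < R"
    proof (rule tendsto_lowerbound[OF cont])
      show "eventually (\<lambda>t. 0 \<le> k t) (at_right (x i))"
        using eventually_at_right_real[OF that]
      proof eventually_elim
        case (elim t)
        then have "- R \<le> t" "t \<le> R" "0 < t - x i" using bounds(1)[of i] by auto
        then show ?case using key[of t] by (simp add: zero_le_mult_iff)
      qed
    qed simp
    \<comment> \<open>At \<open>R\<close> the function \<open>x\<close> is maximal, so
      \<open>Lap x i \<ge> 0\<close> and the choice of \<open>R\<close> makes the residual positive,
      against \<open>le\<close>.\<close>
    have "x i \<noteq> R"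
    proof
      assume xR: "x i = R"
      then have "0 \<le> dt * Lap x i"
        using dt bounds by (intro mult_nonneg_nonneg Lap_nonneg_at_max) auto
      then have "0 < k (x i)" using b_less[OF i] by (simp add: k_def xR)
      then show False using le xR R by simp
    qed
    moreover have "x i \<noteq> - R"
    proof
      assume xR: "x i = - R"
      then have "0 \<le> dt * Lap (\<lambda>j. - x j) i"
        using dt bounds by (intro mult_nonneg_nonneg Lap_nonneg_at_max) (auto simp: minus_le_iff)
      then have "k (x i) < 0" using b_less[OF i] by (simp add: k_def xR Lap_minus[OF supp])
      then show False using ge xR R by simp
    qed
    ultimately have "k (x i) = 0" using le ge bounds[of i] by force
    then show ?thesis by (simp add: k_def)
  qed
  then show ?thesis using supp by blast
qed

text \<open>\<open>v\<close> is the old iterate and \<open>x\<close> the new one.\<close>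

definition implicit_step :: "real \<Rightarrow> real \<Rightarrow> (int \<Rightarrow> real) \<Rightarrow> (int \<Rightarrow> real) \<Rightarrow> bool" where
  "implicit_step q dt v x \<longleftrightarrow>
     (\<forall>i\<in>grid. (odd_powr (x i) (q - 1) - odd_powr (v i) (q - 1)) / dt + Lap x i = 0)"

lemma implicit_step_exists:
  assumes "1 < q" "0 < dt"
  shows "\<exists>x. supported x \<and> implicit_step q dt v x"
proof -
  obtain x where "supported x" and x: "\<And>i. i \<in> grid \<Longrightarrow> odd_powr (x i) (q - 1) + dt * Lap x i = odd_powr (v i) (q - 1)"
    using resolvent_exists[OF assms, of "\<lambda>i. odd_powr (v i) (q - 1)"] by blast
  moreover have "implicit_step q dt v x"
    unfolding implicit_step_def using assms by (auto simp: field_simps x[symmetric])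
  ultimately show ?thesis by blast
qed

text \<open>Testing the difference of the equations with \<open>x - y\<close> gives a nonpositive
  right side, while strict monotonicity makes each term on the left positive where \<open>x\<close>
  and \<open>y\<close> differ.\<close>

lemma implicit_step_unique:
  assumes q: "1 < q" and dt: "0 < dt"
    and "supported x" "supported y" "implicit_step q dt v x" "implicit_step q dt v y"
  shows "x = y"
proof -
  let ?A = "\<lambda>x i. odd_powr (x i) (q - 1)"
  have "?A x i - ?A y i = - dt * (Lap x i - Lap y i)" if "i \<in> grid" for i
  proof -
    have "(?A x i - ?A v i) / dt + Lap x i = 0" "(?A y i - ?A v i) / dt + Lap y i = 0"
      using assms(5,6) that by (auto simp: implicit_step_def)
    then show ?thesis using dt by (simp add: field_simps)
  qed
  then have "(\<Sum>i\<in>grid. (?A x i - ?A y i) * (x i - y i))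
      = (\<Sum>i\<in>grid. - dt * ((x i - y i) * Lap (\<lambda>i. x i - y i) i))"
    by (intro sum.cong) (auto simp: Lap_diff assms)
  also have "\<dots> = - dt * form (\<lambda>i. x i - y i) (\<lambda>i. x i - y i)"
    by (simp only: form_def sum_distrib_left)
  also have "\<dots> \<le> 0"
    using dt form_nonneg[OF supported_diff[OF assms(3,4)]] by simp
  finally have le: "(\<Sum>i\<in>grid. (?A x i - ?A y i) * (x i - y i)) \<le> 0" .
  have pos: "0 < (?A x i - ?A y i) * (x i - y i)" if "x i \<noteq> y i" for i
    using odd_powr_strict_mono[of "q - 1" "x i" "y i"] odd_powr_strict_mono[of "q - 1" "y i" "x i"] q that
    by (cases "x i" "y i" rule: linorder_cases) (auto simp: mult_neg_neg)
  have nonneg: "0 \<le> (?A x i - ?A y i) * (x i - y i)" for i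
    using pos[of i] by (cases "x i = y i") auto
  have "x i = y i" if "i \<in> grid" for i
  proof -
    have "(?A x i - ?A y i) * (x i - y i) \<le> (\<Sum>i\<in>grid. (?A x i - ?A y i) * (x i - y i))"
      using that nonneg by (intro member_le_sum) auto
    then show ?thesis using pos[of i] le by force
  qed
  then show ?thesis
    using supportedD[OF assms(3)] supportedD[OF assms(4)] by (metis ext)
qed

section \<open>Energy estimates for one step\<close>

text \<open>The weak form of the step, with test function \<open>f\<close>.\<close>

lemma implicit_step_sum:
  assumes "0 < dt" "implicit_step q dt v x"
  shows "(\<Sum>i\<in>grid. f i * (odd_powr (x i) (q - 1) - odd_powr (v i) (q - 1))) = - dt * form f x"
proof -
  have "f i * (odd_powr (x i) (q - 1) - odd_powr (v i) (q - 1)) = - dt * (f i * Lap x i)" if "i \<in> grid" for i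
  proof -
    have "(odd_powr (x i) (q - 1) - odd_powr (v i) (q - 1)) / dt = - Lap x i"
      using assms(2) that unfolding implicit_step_def by (simp add: add_eq_0_iff2)
    then have "odd_powr (x i) (q - 1) - odd_powr (v i) (q - 1) = - dt * Lap x i"
      using assms by (simp add: field_simps)
    then show ?thesis by simp
  qed
  then show ?thesis by (simp add: form_def sum_distrib_left)
qed

lemma form_polarization_le:
  assumes "supported x" "supported v"
  shows "form v x \<le> (form x x + form v v) / 2"
  using form_nonneg[OF supported_diff[OF assms]]
  by (simp add: form_diff_left form_diff_right assms form_commute[OF assms])

text \<open>Test with \<open>x - v\<close>: Stroock--Varopoulos bounds the sum from below,
  polarization bounds the form from above.\<close>

lemma implicit_step_dissipation:
  assumes q: "1 < q" and dt: "0 < dt" and supp: "supported x" "supported v"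
    and step: "implicit_step q dt v x"
  shows "4 * (q - 1) / q\<^sup>2 * (\<Sum>i\<in>grid. (odd_powr (x i) (q / 2) - odd_powr (v i) (q / 2))\<^sup>2)
    \<le> - dt / 2 * (form x x - form v v)"
proof -
  have "4 * (q - 1) / q\<^sup>2 * (\<Sum>i\<in>grid. (odd_powr (x i) (q / 2) - odd_powr (v i) (q / 2))\<^sup>2)
    \<le> (\<Sum>i\<in>grid. (odd_powr (x i) (q - 1) - odd_powr (v i) (q - 1)) * (x i - v i))"
    unfolding sum_distrib_left by (intro sum_mono Stroock_Varopoulos_odd_powr q)
  also have "\<dots> = (\<Sum>i\<in>grid. (x i - v i) * (odd_powr (x i) (q - 1) - odd_powr (v i) (q - 1)))"
    by (simp add: mult.commute)
  also have "\<dots> = - dt * (form x x - form v x)"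
    by (simp add: implicit_step_sum[OF dt step] form_diff_left)
  also have "\<dots> \<le> - dt * (form x x - (form x x + form v v) / 2)"
    using form_polarization_le[OF supp] dt by (simp add: mult_left_mono)
  finally show ?thesis by (simp add: field_simps)
qed

lemma implicit_step_form_decreasing:
  assumes q: "1 < q" and dt: "0 < dt" and supp: "supported x" "supported v"
    and step: "implicit_step q dt v x"
  shows "form x x \<le> form v v"
proof -
  have "0 \<le> 4 * (q - 1) / q\<^sup>2 * (\<Sum>i\<in>grid. (odd_powr (x i) (q / 2) - odd_powr (v i) (q / 2))\<^sup>2)"
    using q by (simp add: sum_nonneg)
  then have "0 \<le> - dt / 2 * (form x x - form v v)"
    using implicit_step_dissipation[OF assms] by (rule order_trans)
  then show ?thesis using dt by (simp add: mult_le_0_iff)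
qed

lemma implicit_step_estimates:
  assumes q: "1 < q" "q' = q / (q - 1)" and dt: "0 < dt" and supp: "supported x" "supported v"
    and step: "implicit_step q dt v x"
  shows "- (X_norm \<theta> h v)\<^sup>2 \<le> 1 / q' * ((lq_norm h q x powr q - lq_norm h q v powr q) / dt)" (is ?th1)
    and "1 / q' * ((lq_norm h q x powr q - lq_norm h q v powr q) / dt) \<le> - (X_norm \<theta> h x)\<^sup>2" (is ?th2)
    and "4 / (q * q') * (lq_norm h 2 (\<lambda>i. (odd_powr (x i) (q / 2) - odd_powr (v i) (q / 2)) / dt))\<^sup>2
      + 1 / 2 * (((X_norm \<theta> h x)\<^sup>2 - (X_norm \<theta> h v)\<^sup>2) / dt) \<le> 0" (is ?th3)
proof -
  have q': "1 / q' = 1 - 1 / q" "4 / (q * q') = 4 * (q - 1) / q\<^sup>2"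
    using q(1) unfolding q(2) by (simp_all add: field_simps power2_eq_square)
  let ?D = "\<Sum>i\<in>grid. (1 - 1 / q) * (\<bar>x i\<bar> powr q - \<bar>v i\<bar> powr q)"
  have D: "1 / q' * ((lq_norm h q x powr q - lq_norm h q v powr q) / dt) = h * (?D / dt)"
    using q supp unfolding q'(1)
    by (simp add: lq_norm_powr sum_subtractf flip: sum_distrib_left right_diff_distrib)
  \<comment> \<open>Test with the old iterate \<open>v\<close>. The mixed term is then at most
    \<open>form v v\<close>, by polarization and decrease of the form.\<close>
  have "- dt * form v x \<le> ?D"
    unfolding implicit_step_sum[OF dt step, symmetric] by (intro sum_mono odd_powr_convexity q)
  moreover have "- dt * form v v \<le> - dt * form v x"
    using form_polarization_le[OF supp] implicit_step_form_decreasing[OF q(1) dt supp step] dt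
    by simp
  ultimately have "- dt * form v v \<le> ?D" by (rule order_trans[rotated])
  then have "- form v v \<le> ?D / dt" using dt by (simp add: pos_le_divide_eq mult.commute)
  then have "h * - form v v \<le> h * (?D / dt)" using h_pos by (intro mult_left_mono) auto
  then show ?th1 unfolding D X_norm_squared[OF supp(2)] by simp
  \<comment> \<open>Test with the new iterate \<open>x\<close>.\<close>
  have "?D \<le> - dt * form x x"
    unfolding implicit_step_sum[OF dt step, symmetric] by (intro sum_mono odd_powr_convexity q)
  then have "?D / dt \<le> - form x x" using dt by (simp add: pos_divide_le_eq mult.commute)
  then have "h * (?D / dt) \<le> h * - form x x" using h_pos by (intro mult_left_mono) auto
  then show ?th2 unfolding D X_norm_squared[OF supp(1)] by simp
  let ?Q = "\<Sum>i\<in>grid. (odd_powr (x i) (q / 2) - odd_powr (v i) (q / 2))\<^sup>2"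
  have "supported (\<lambda>i. (odd_powr (x i) (q / 2) - odd_powr (v i) (q / 2)) / dt)"
    using supp by (simp add: supported_def)
  then have N: "(lq_norm h 2 (\<lambda>i. (odd_powr (x i) (q / 2) - odd_powr (v i) (q / 2)) / dt))\<^sup>2 = h * (?Q / dt\<^sup>2)"
    by (simp add: l2_norm_squared power_divide sum_divide_distrib)
  have gather: "A * (h * (Q / dt\<^sup>2)) + 1 / 2 * ((h * a - h * b) / dt)
      = h / dt\<^sup>2 * (A * Q - (- dt / 2 * (a - b)))" for A Q a b
    using dt by (simp add: field_simps power2_eq_square)
  have "4 / (q * q') * (lq_norm h 2 (\<lambda>i. (odd_powr (x i) (q / 2) - odd_powr (v i) (q / 2)) / dt))\<^sup>2
      + 1 / 2 * (((X_norm \<theta> h x)\<^sup>2 - (X_norm \<theta> h v)\<^sup>2) / dt)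
      = h / dt\<^sup>2 * (4 * (q - 1) / q\<^sup>2 * ?Q - (- dt / 2 * (form x x - form v v)))"
    unfolding N X_norm_squared[OF supp(1)] X_norm_squared[OF supp(2)] q'(2) by (rule gather)
  also have "\<dots> \<le> 0"
    using implicit_step_dissipation[OF q(1) dt supp step] h_pos by (intro mult_nonneg_nonpos) auto
  finally show ?th3 .
qed

section \<open>The scheme as a sequence of implicit steps\<close>

lemma is_scheme_solution_iff:
  assumes "supported u0"
  shows "is_scheme_solution \<theta> h M q dt u0 u \<longleftrightarrow>
    u 0 = u0 \<and> (\<forall>n. supported (u n) \<and> implicit_step q dt (u n) (u (Suc n)))"
proof -
  have grid: "\<bar>i\<bar> \<le> int M \<longleftrightarrow> i \<in> grid" "int M + 1 \<le> \<bar>i\<bar> \<longleftrightarrow> i \<notin> grid" for i by auto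
  have "(\<forall>n. supported (u n)) \<Longrightarrow> u 0 = u0 \<longleftrightarrow> (\<forall>i\<in>grid. u 0 i = u0 i)"
    using assms by (auto simp: fun_eq_iff supported_def)
  then show ?thesis
    unfolding is_scheme_solution_def grid implicit_step_def supported_def by blast
qed

text \<open>Existence follows by dependent choice of successive steps, uniqueness by induction on
  \<open>n\<close>.\<close>

lemma scheme_solution_ex1:
  assumes "1 < q" "0 < dt" "supported u0"
  shows "\<exists>!u. is_scheme_solution \<theta> h M q dt u0 u"
proof (rule ex_ex1I)
  have "\<exists>u. \<forall>n. (supported (u n) \<and> (n = 0 \<longrightarrow> u n = u0)) \<and> implicit_step q dt (u n) (u (Suc n))"
    by (rule dependent_nat_choice) (use assms implicit_step_exists in auto)
  then show "\<exists>u. is_scheme_solution \<theta> h M q dt u0 u"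
    unfolding is_scheme_solution_iff[OF assms(3)] by blast
next
  fix u v
  assume "is_scheme_solution \<theta> h M q dt u0 u" "is_scheme_solution \<theta> h M q dt u0 v"
  then have u: "u 0 = u0" "\<And>n. supported (u n)" "\<And>n. implicit_step q dt (u n) (u (Suc n))"
    and v: "v 0 = u0" "\<And>n. supported (v n)" "\<And>n. implicit_step q dt (v n) (v (Suc n))"
    unfolding is_scheme_solution_iff[OF assms(3)] by auto
  have "u n = v n" for n
  proof (induction n)
    case (Suc n)
    show ?case
      using u(3)[of n] v(3)[of n] unfolding Suc
      by (rule implicit_step_unique[OF assms(1,2) u(2) v(2)])
  qed (simp add: u v)
  then show "u = v" by blast
qed

end

theorem proposition6:
  fixes \<theta> L h q q' dt :: real and M :: nat and u0 :: "int \<Rightarrow> real"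
  assumes "0 < \<theta>" and "\<theta> < 1" and "0 < L"
    and "0 < h" and "1 \<le> M" and "L = (real M + 1) * h"
    and "1 < q" and "q' = q / (q - 1)" and "0 < dt"
    and "\<And>i. \<bar>i\<bar> > int M \<Longrightarrow> u0 i = 0"
  shows "(\<exists>!u. is_scheme_solution \<theta> h M q dt u0 u) \<and>
    (\<forall>u. is_scheme_solution \<theta> h M q dt u0 u \<longrightarrow>
      (\<forall>n.
        - (X_norm \<theta> h (u n))\<^sup>2
          \<le> 1 / q' * ((lq_norm h q (u (Suc n)) powr q - lq_norm h q (u n) powr q) / dt) \<and>
        1 / q' * ((lq_norm h q (u (Suc n)) powr q - lq_norm h q (u n) powr q) / dt)
          \<le> - (X_norm \<theta> h (u (Suc n)))\<^sup>2 \<and>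
        4 / (q * q') *
            (lq_norm h 2 (\<lambda>i. (odd_powr (u (Suc n) i) (q / 2) - odd_powr (u n i) (q / 2)) / dt))\<^sup>2
          + 1 / 2 * (((X_norm \<theta> h (u (Suc n)))\<^sup>2 - (X_norm \<theta> h (u n))\<^sup>2) / dt) \<le> 0))"
proof -
  interpret fractional_grid \<theta> h M
    using assms by unfold_locales
  have u0: "supported u0" using assms(10) by (auto simp: supported_def)
  show ?thesis
  proof (intro conjI allI impI)
    show "\<exists>!u. is_scheme_solution \<theta> h M q dt u0 u"
      by (rule scheme_solution_ex1[OF assms(7,9) u0])
  next
    fix u n
    assume "is_scheme_solution \<theta> h M q dt u0 u"
    then have "supported (u (Suc n))" "supported (u n)" "implicit_step q dt (u n) (u (Suc n))"
      unfolding is_scheme_solution_iff[OF u0] by auto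
    note * = implicit_step_estimates[OF assms(7,8,9) this]
    from *(1) *(2) *(3) show
      "- (X_norm \<theta> h (u n))\<^sup>2
        \<le> 1 / q' * ((lq_norm h q (u (Suc n)) powr q - lq_norm h q (u n) powr q) / dt)"
      "1 / q' * ((lq_norm h q (u (Suc n)) powr q - lq_norm h q (u n) powr q) / dt)
        \<le> - (X_norm \<theta> h (u (Suc n)))\<^sup>2"
      "4 / (q * q') *
          (lq_norm h 2 (\<lambda>i. (odd_powr (u (Suc n) i) (q / 2) - odd_powr (u n i) (q / 2)) / dt))\<^sup>2
        + 1 / 2 * (((X_norm \<theta> h (u (Suc n)))\<^sup>2 - (X_norm \<theta> h (u n))\<^sup>2) / dt) \<le> 0"
      by - assumption+
  qed
qed

end
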